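(* Let $\gamma\le 0$ and assume (Increments), (Waiting times) and (Integrability) as described in the context. Let $\pi_0\in\mathcal{S}$ be fixed. Then there exists a solution $(\bar v^\gamma,\bar\lambda^\gamma)\in \mathcal{C}_b(\mathcal{S})\times\mathbb{R}$ to the Bellman equation $$\bar v^\gamma(\pi)=\sup_{\pi'\in\mathcal{S}}\Big(\ln s(\pi,\pi')-\bar\lambda^\gamma\,\mathbb{E}[\eta_1]+\mu^\gamma\big[\ln\langle \pi',R(\eta_1)\rangle+\bar v^\gamma(G(\pi',R(\eta_1)))\big]\Big),\qquad \pi\in\mathcal{S},$$ such that: (i) the lift $\mathcal{W}_{\bar v^\gamma}$ is concave and positively homogeneous on $\mathbb{R}^d_+$; (ii) after the normalisation $\max_{\mathcal{S}}\bar v^\gamma=0$ (i.e. after replacing $\bar v^\gamma$ by $\bar v^\gamma-\max_{\mathcal{S}}\bar v^\gamma$ in the lift), one has $\bar s\,\langle x,\mathbf{1}\rangle\le \mathcal{W}_{\bar v^\gamma}(x)\le \langle x,\mathbf{1}\rangle$ for all $x\in\mathbb{R}^d_+$; (iii) $\bar v^\gamma$ is Lipschitz (with respect to $\|\cdot\|_1$) with constant $L:=\frac{\bar c}{(1-\bar c)\bar s}$, and $\sup_{\mathcal{S}}\bar v^\gamma-\inf_{\mathcal{S}}\bar v^\gamma\le \ln\frac1{\bar s}$; (iv) $\bar\lambda^\gamma=\frac{1}{\mathbb{E}[\eta_1]}(\mathcal{T}\bar v^\gamma)(\pi_0)$.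
   Context: Notation. $d\ge1$; $\langle x,y\rangle$ is the scalar product, $x\cdot y$ the component-wise product, $\|x\|_1=\sum_i|x_i|$ on $\mathbb{R}^d$; $\mathbf{1}=(1,\dots,1)$. $\mathcal{S}=\{\pi\in\mathbb{R}^d:\pi_i\ge0,\ \langle\pi,\mathbf{1}\rangle=1\}$; $\mathcal{C}_b(\mathcal{S})$ is the space of bounded continuous real functions on $\mathcal{S}$. $G(x,y):=\frac{x\cdot y}{\langle x,y\rangle}$. Transaction costs. $c_i,h_i\in[0,1)$, $i=1,\dots,d$; $p(x):=\sum_{i=1}^d\max(c_ix_i,-h_ix_i)$ for $x\in\mathbb{R}^d$; $\bar c:=\max_i\max(c_i,h_i)$; $\bar s:=\frac{1-\bar c}{1+\bar c}$. For $\pi,\pi'\in\mathcal{S}$, $s(\pi,\pi')$ denotes the unique $w>0$ with $w+p(w\pi'-\pi)=1$ (the ratio of wealth after to wealth before rebalancing from weights $\pi$ to $\pi'$). Market. $S(t)=(S_1(t),\dots,S_d(t))$, $t\ge0$, is a process of strictly positive prices, $R(t_1,t_2)=(S_i(t_2)/S_i(t_1))_{i}$, $R(t)=R(0,t)$, $r(t)=\ln R(t)$ (component-wise). $(\eta_i)_{i\ge1}$ are i.i.d. $(0,\infty)$-valued random variables, independent of the price process. (Increments): $t\mapsto\ln S(t)$ is right-continuous and has stationary independent increments. (Waiting times): $\mathbb{P}[\eta_i>0]=1$ and $\mathbb{E}[\eta_i]<\infty$. (Integrability): for any $\gamma<0$, $\mathbb{E}[e^{\gamma\min_i r_i(\eta_1)}]<\infty$,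 and $\mathbb{E}[\max_i r_i(\eta_1)]<\infty$. Entropic utility. $\mu^\gamma[Z]:=\frac1\gamma\ln\mathbb{E}[e^{\gamma Z}]$ for $\gamma<0$ and $\mu^0[Z]:=\mathbb{E}[Z]$. Lift. For $v\in\mathcal{C}_b(\mathcal{S})$: $\mathcal{W}_v(x):=\langle x,\mathbf{1}\rangle e^{v(x/\langle x,\mathbf{1}\rangle)}$ for $x\in\mathbb{R}^d_+\setminus\{\mathbf{0}\}$, $\mathcal{W}_v(\mathbf{0}):=0$. Bellman operator. $\mathcal{T}v(\pi):=\sup_{\pi'\in\mathcal{S}}\big(\ln s(\pi,\pi')+\mu^\gamma[\ln\langle\pi',R(\eta_1)\rangle+v(G(\pi',R(\eta_1)))]\big)$, $\pi\in\mathcal{S}$. *)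

theory Defs
  imports "HOL-Probability.Probability"
begin

text \<open>
  Vectors of \<open>\<real>\<^sup>d\<close> are elements of \<^typ>\<open>real ^ 'n\<close>, with \<open>d = CARD('n)\<close>, so that \<open>d \<ge> 1\<close>.
  On this type \<open>*\<close> is the component-wise product, \<open>1\<close> is the vector with all components \<open>1\<close>,
  and \<open>\<bullet>\<close> is the scalar product.
\<close>

definition l1_norm :: "real ^ 'n \<Rightarrow> real" where
  "l1_norm x = (\<Sum>i\<in>UNIV. \<bar>x $ i\<bar>)"

definition weights :: "(real ^ 'n) set" where
  "weights = {\<pi>. (\<forall>i. 0 \<le> \<pi> $ i) \<and> \<pi> \<bullet> 1 = 1}"

definition orthant :: "(real ^ 'n) set" where
  "orthant = {x. \<forall>i. 0 \<le> x $ i}"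

definition bounded_continuous :: "(real ^ 'n \<Rightarrow> real) \<Rightarrow> bool" where
  "bounded_continuous v \<longleftrightarrow> continuous_on weights v \<and> bounded (v ` weights)"

definition drift_weights :: "real ^ 'n \<Rightarrow> real ^ 'n \<Rightarrow> real ^ 'n" where
  "drift_weights x y = (1 / (x \<bullet> y)) *\<^sub>R (x * y)"


section \<open>Transaction costs\<close>

definition cost :: "real ^ 'n \<Rightarrow> real ^ 'n \<Rightarrow> real ^ 'n \<Rightarrow> real" where
  "cost c h x = (\<Sum>i\<in>UNIV. max (c $ i * x $ i) (- h $ i * x $ i))"

definition cost_bound :: "real ^ 'n \<Rightarrow> real ^ 'n \<Rightarrow> real" where
  "cost_bound c h = Max (range (\<lambda>i. max (c $ i) (h $ i)))"

definition shrink_bound :: "real ^ 'n \<Rightarrow> real ^ 'n \<Rightarrow> real" where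
  "shrink_bound c h = (1 - cost_bound c h) / (1 + cost_bound c h)"

definition shrink :: "real ^ 'n \<Rightarrow> real ^ 'n \<Rightarrow> real ^ 'n \<Rightarrow> real ^ 'n \<Rightarrow> real" where
  "shrink c h \<pi> \<pi>' = (THE w. w > 0 \<and> w + cost c h (w *\<^sub>R \<pi>' - \<pi>) = 1)"


section \<open>Market\<close>

text \<open>
  The process \<open>S\<close> is indexed by \<^typ>\<open>real\<close>, but only times \<open>t \<ge> 0\<close> are constrained and used;
  likewise the waiting times are \<open>\<eta> i\<close> for \<open>i \<ge> 1\<close>.  The last condition says that the sequence
  of waiting times and the whole price process are independent; it is stated through the
  sigma-algebras they generate because the two random elements have different types.
\<close>

definition market :: "'w measure \<Rightarrow> (real \<Rightarrow> 'w \<Rightarrow> real ^ 'n) \<Rightarrow> (nat \<Rightarrow> 'w \<Rightarrow> real) \<Rightarrow> bool" where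
  "market M S \<eta> \<longleftrightarrow>
     prob_space M \<and>
     (\<forall>t\<ge>0. S t \<in> borel_measurable M) \<and>
     (\<forall>t\<ge>0. \<forall>\<omega>\<in>space M. \<forall>i. 0 < S t \<omega> $ i) \<and>
     (\<forall>i\<ge>1. \<forall>\<omega>\<in>space M. 0 < \<eta> i \<omega>) \<and>
     prob_space.indep_vars M (\<lambda>_. borel) \<eta> {1..} \<and>
     (\<forall>i\<ge>1. distr M borel (\<eta> i) = distr M borel (\<eta> 1)) \<and>
     prob_space.indep_set M
       (sets (vimage_algebra (space M) (\<lambda>\<omega>. \<lambda>i\<in>{1..}. \<eta> i \<omega>) (Pi\<^sub>M {1..} (\<lambda>_. borel))))
       (sets (vimage_algebra (space M) (\<lambda>\<omega>. \<lambda>t\<in>{0..}. S t \<omega>) (Pi\<^sub>M {0..} (\<lambda>_. borel))))"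

definition ln_vec :: "real ^ 'n \<Rightarrow> real ^ 'n" where
  "ln_vec x = (\<chi> i. ln (x $ i))"

definition price_ratio :: "(real \<Rightarrow> 'w \<Rightarrow> real ^ 'n) \<Rightarrow> real \<Rightarrow> real \<Rightarrow> 'w \<Rightarrow> real ^ 'n" where
  "price_ratio S t1 t2 \<omega> = (\<chi> i. S t2 \<omega> $ i / S t1 \<omega> $ i)"

text \<open>
  \<open>gross_return S T\<close> is the random vector \<open>R(T)\<close> for a random time \<open>T\<close>, and \<open>log_return S T\<close>
  is \<open>r(T)\<close>.
\<close>

definition gross_return :: "(real \<Rightarrow> 'w \<Rightarrow> real ^ 'n) \<Rightarrow> ('w \<Rightarrow> real) \<Rightarrow> 'w \<Rightarrow> real ^ 'n" where
  "gross_return S T \<omega> = price_ratio S 0 (T \<omega>) \<omega>"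

definition log_return :: "(real \<Rightarrow> 'w \<Rightarrow> real ^ 'n) \<Rightarrow> ('w \<Rightarrow> real) \<Rightarrow> 'w \<Rightarrow> real ^ 'n" where
  "log_return S T \<omega> = ln_vec (gross_return S T \<omega>)"

definition right_continuous_paths :: "'w measure \<Rightarrow> (real \<Rightarrow> 'w \<Rightarrow> real ^ 'n) \<Rightarrow> bool" where
  "right_continuous_paths M X \<longleftrightarrow> (\<forall>\<omega>\<in>space M. \<forall>t\<ge>0. continuous (at_right t) (\<lambda>u. X u \<omega>))"

definition stationary_increments :: "'w measure \<Rightarrow> (real \<Rightarrow> 'w \<Rightarrow> real ^ 'n) \<Rightarrow> bool" where
  "stationary_increments M X \<longleftrightarrow>
     (\<forall>t\<ge>0. \<forall>u\<ge>0. distr M borel (\<lambda>\<omega>. X (t + u) \<omega> - X t \<omega>) = distr M borel (\<lambda>\<omega>. X u \<omega> - X 0 \<omega>))"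

definition independent_increments :: "'w measure \<Rightarrow> (real \<Rightarrow> 'w \<Rightarrow> real ^ 'n) \<Rightarrow> bool" where
  "independent_increments M X \<longleftrightarrow>
     (\<forall>(m::nat) \<tau>. 0 \<le> \<tau> 0 \<and> (\<forall>k<m. \<tau> k < \<tau> (Suc k)) \<longrightarrow>
        prob_space.indep_vars M (\<lambda>_. borel) (\<lambda>k \<omega>. X (\<tau> (Suc k)) \<omega> - X (\<tau> k) \<omega>) {..<m})"

definition increments_assm :: "'w measure \<Rightarrow> (real \<Rightarrow> 'w \<Rightarrow> real ^ 'n) \<Rightarrow> bool" where
  "increments_assm M S \<longleftrightarrow>
     (let X = (\<lambda>t \<omega>. ln_vec (S t \<omega>)) in
        right_continuous_paths M X \<and> stationary_increments M X \<and> independent_increments M X)"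

definition waiting_times_assm :: "'w measure \<Rightarrow> (nat \<Rightarrow> 'w \<Rightarrow> real) \<Rightarrow> bool" where
  "waiting_times_assm M \<eta> \<longleftrightarrow>
     (\<forall>i\<ge>1. measure M {\<omega>\<in>space M. 0 < \<eta> i \<omega>} = 1 \<and> integrable M (\<eta> i))"

text \<open>
  Given the exponential condition, the negative part of \<open>max\<^sub>i r\<^sub>i\<close> is integrable, so
  \<open>E[max\<^sub>i r\<^sub>i] < \<infinity>\<close> is the same as integrability.
\<close>

definition integrability_assm ::
    "'w measure \<Rightarrow> (real \<Rightarrow> 'w \<Rightarrow> real ^ 'n) \<Rightarrow> (nat \<Rightarrow> 'w \<Rightarrow> real) \<Rightarrow> bool" where
  "integrability_assm M S \<eta> \<longleftrightarrow>
     (\<forall>\<gamma><0. integrable M (\<lambda>\<omega>. exp (\<gamma> * Min (range (\<lambda>i. log_return S (\<eta> 1) \<omega> $ i))))) \<and>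
     integrable M (\<lambda>\<omega>. Max (range (\<lambda>i. log_return S (\<eta> 1) \<omega> $ i)))"


section \<open>Entropic utility, lift and Bellman operator\<close>

text \<open>Used for \<open>\<gamma> \<le> 0\<close> only.\<close>

definition entropic_utility :: "'w measure \<Rightarrow> real \<Rightarrow> ('w \<Rightarrow> real) \<Rightarrow> real" where
  "entropic_utility M \<gamma> Z =
     (if \<gamma> = 0 then (LINT \<omega>|M. Z \<omega>) else 1 / \<gamma> * ln (LINT \<omega>|M. exp (\<gamma> * Z \<omega>)))"

definition wealth_lift :: "(real ^ 'n \<Rightarrow> real) \<Rightarrow> real ^ 'n \<Rightarrow> real" where
  "wealth_lift v x = (if x = 0 then 0 else (x \<bullet> 1) * exp (v ((1 / (x \<bullet> 1)) *\<^sub>R x)))"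

definition positively_homogeneous_on :: "(real ^ 'n) set \<Rightarrow> (real ^ 'n \<Rightarrow> real) \<Rightarrow> bool" where
  "positively_homogeneous_on A f \<longleftrightarrow> (\<forall>x\<in>A. \<forall>a\<ge>0. f (a *\<^sub>R x) = a * f x)"

text \<open>The term \<open>\<mu>\<^sup>\<gamma>[ln \<langle>\<pi>', R(\<eta>\<^sub>1)\<rangle> + v(G(\<pi>', R(\<eta>\<^sub>1)))]\<close> of the Bellman equation.\<close>

definition continuation_utility ::
    "'w measure \<Rightarrow> (real \<Rightarrow> 'w \<Rightarrow> real ^ 'n) \<Rightarrow> (nat \<Rightarrow> 'w \<Rightarrow> real) \<Rightarrow> real \<Rightarrow>
     (real ^ 'n \<Rightarrow> real) \<Rightarrow> real ^ 'n \<Rightarrow> real" where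
  "continuation_utility M S \<eta> \<gamma> v \<pi>' =
     entropic_utility M \<gamma>
       (\<lambda>\<omega>. ln (\<pi>' \<bullet> gross_return S (\<eta> 1) \<omega>) + v (drift_weights \<pi>' (gross_return S (\<eta> 1) \<omega>)))"

definition bellman_operator ::
    "'w measure \<Rightarrow> (real \<Rightarrow> 'w \<Rightarrow> real ^ 'n) \<Rightarrow> (nat \<Rightarrow> 'w \<Rightarrow> real) \<Rightarrow> real ^ 'n \<Rightarrow> real ^ 'n \<Rightarrow> real \<Rightarrow>
     (real ^ 'n \<Rightarrow> real) \<Rightarrow> real ^ 'n \<Rightarrow> real" where
  "bellman_operator M S \<eta> c h \<gamma> v \<pi> =
     (SUP \<pi>'\<in>weights. ln (shrink c h \<pi> \<pi>') + continuation_utility M S \<eta> \<gamma> v \<pi>')"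

end

theory Submission
  imports Defs "HOL-Complex_Analysis.Great_Picard"
begin

text \<open>
  The equation is solved by vanishing discount.  The operator \<open>T\<close> on the right-hand side of the
  Bellman equation (without \<open>\<lambda>\<close>) is monotone and commutes with adding constants, so it is
  nonexpansive in the supremum norm and \<open>v \<mapsto> T (\<beta> v)\<close> is a contraction for \<open>0 \<le> \<beta> < 1\<close>.  Let
  \<open>v\<^sub>\<beta>\<close> be its fixed point.  The initial portfolio enters \<open>T v\<close> only through the shrinkage factor
  \<open>s(\<pi>, \<pi>')\<close>, which lies in \<open>[sbar, 1]\<close> and whose logarithm is Lipschitz in \<open>\<pi>\<close> uniformly in \<open>\<pi>'\<close>.
  So every function in the range of \<open>T\<close> oscillates by at most \<open>ln (1 / sbar)\<close> and has the Lipschitz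
  constant of the claim (\<open>bellman_oscillation\<close>, \<open>bellman_lipschitz\<close>), for every continuous \<open>v\<close>.  By the
  theorem of Arzela and Ascoli the functions \<open>w\<^sub>\<beta> = v\<^sub>\<beta> - v\<^sub>\<beta> \<pi>\<^sub>0\<close> have a limit point \<open>w\<close> as \<open>\<beta> \<rightarrow> 1\<close>,
  and passing to the limit in \<open>w\<^sub>\<beta> = T (\<beta> w\<^sub>\<beta>) - T (\<beta> w\<^sub>\<beta>) \<pi>\<^sub>0\<close> gives \<open>w = T w - T w \<pi>\<^sub>0\<close>
  (\<open>ergodic_solution\<close>).  This is the Bellman equation with \<open>\<lambda> E[\<eta>\<^sub>1] = T w \<pi>\<^sub>0\<close>, and the bounds on \<open>w\<close>
  follow from those on the range of \<open>T\<close>.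

  Concavity is carried along by the iteration.  The lift of \<open>v\<close> is the perspective of \<open>exp \<circ> v\<close>, so
  it is concave on the orthant if and only if \<open>exp \<circ> v\<close> is concave on the simplex, and the latter
  property is what the lemmas propagate.  It passes from \<open>v\<close> to \<open>T v\<close> for three reasons:
  wealth after a price move is the lift composed with a linear map (\<open>growth_concave\<close>), the
  certainty equivalent of a random wealth is concave (\<open>certainty_equivalent_concave\<close>), and
  mixtures of affordable trades are affordable because the cost is convex
  (\<open>shrink_convex_combination\<close>).  It passes from \<open>v\<close> to \<open>\<beta> v\<close> because powers with exponent at
  most one are concave (\<open>concave_on_exp_scale\<close>), and it survives limits.

  The vector \<open>R(\<eta>\<^sub>1)\<close> of gross returns is a random variable because the logarithmic prices are
  right-continuous, so that prices at a random time are limits of prices at times on grids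
  (\<open>right_continuous_random_time_measurable\<close>).
\<close>

section \<open>The simplex of weights\<close>

lemma inner_one_eq_sum: "x \<bullet> (1 :: real ^ 'n) = (\<Sum>i\<in>UNIV. x $ i)"
  by (simp add: inner_vec_def)

lemma weights_nonneg: "\<pi> \<in> weights \<Longrightarrow> 0 \<le> \<pi> $ i"
  by (simp add: weights_def)

lemma weights_sum: "\<pi> \<in> weights \<Longrightarrow> (\<Sum>i\<in>UNIV. \<pi> $ i) = 1"
  by (simp add: weights_def inner_one_eq_sum)

lemma weights_l1_norm: "\<pi> \<in> weights \<Longrightarrow> l1_norm \<pi> = 1"
  by (simp add: l1_norm_def weights_nonneg weights_sum)

lemma l1_norm_scaled_weights: "\<pi> \<in> weights \<Longrightarrow> l1_norm (w *\<^sub>R \<pi>) = \<bar>w\<bar>"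
  using weights_l1_norm[of \<pi>] by (simp add: l1_norm_def abs_mult flip: sum_distrib_left)

lemma l1_norm_triangle: "l1_norm (x - y) \<le> l1_norm x + l1_norm y"
  unfolding l1_norm_def sum.distrib[symmetric] by (intro sum_mono) auto

lemma convex_weights: "convex (weights :: (real ^ 'n) set)"
  by (auto simp: convex_def weights_def inner_add_left)

lemma compact_weights: "compact (weights :: (real ^ 'n) set)"
proof -
  have eq: "weights = (\<Inter>i. {\<pi> :: real ^ 'n. 0 \<le> \<pi> $ i}) \<inter> {\<pi>. \<pi> \<bullet> 1 = 1}"
    by (auto simp: weights_def)
  have "closed (weights :: (real ^ 'n) set)"
    unfolding eq
    by (intro closed_Int closed_INT ballI closed_Collect_le closed_Collect_eq continuous_intros)
  moreover have "norm \<pi> \<le> 1" if "\<pi> \<in> weights" for \<pi> :: "real ^ 'n"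
    using norm_le_l1_cart[of \<pi>] weights_l1_norm[OF that] by (simp add: l1_norm_def)
  ultimately show ?thesis
    by (auto simp: compact_eq_bounded_closed intro!: boundedI)
qed

lemma weights_nonempty: "(weights :: (real ^ 'n) set) \<noteq> {}"
proof -
  have "axis undefined 1 \<in> (weights :: (real ^ 'n) set)"
    by (auto simp: weights_def inner_axis inner_commute[of _ 1]) (simp add: axis_def)
  then show ?thesis by auto
qed

lemma continuous_on_weights_bounded:
  assumes "continuous_on weights (v :: real ^ 'n \<Rightarrow> real)"
  obtains K where "0 \<le> K" "\<And>\<pi>. \<pi> \<in> weights \<Longrightarrow> \<bar>v \<pi>\<bar> \<le> K"
proof -
  have "bounded (v ` weights)"
    using compact_continuous_image[OF assms compact_weights] by (rule compact_imp_bounded)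
  then show ?thesis
    unfolding bounded_pos using that by (metis image_eqI less_imp_le real_norm_def)
qed

lemma weights_inner_ge:
  assumes "\<pi> \<in> weights" "\<And>i. m \<le> y $ i"
  shows "m \<le> \<pi> \<bullet> y"
proof -
  have "m = (\<Sum>i\<in>UNIV. \<pi> $ i * m)"
    using weights_sum[OF assms(1)] by (simp flip: sum_distrib_right)
  also have "\<dots> \<le> (\<Sum>i\<in>UNIV. \<pi> $ i * y $ i)"
    by (intro sum_mono mult_left_mono assms weights_nonneg)
  finally show ?thesis by (simp add: inner_vec_def)
qed

lemma weights_inner_le:
  assumes "\<pi> \<in> weights" "\<And>i. y $ i \<le> m"
  shows "\<pi> \<bullet> y \<le> m"
  using weights_inner_ge[OF assms(1), of "- m" "- y"] assms(2) by simp

lemma weights_inner_pos: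
  assumes "\<pi> \<in> weights" "\<And>i. 0 < y $ i"
  shows "0 < \<pi> \<bullet> y"
proof -
  have "0 < Min (range (($) y))"
    using assms(2) by (subst Min_gr_iff) auto
  also have "\<dots> \<le> \<pi> \<bullet> y"
    by (rule weights_inner_ge[OF assms(1)]) simp
  finally show ?thesis .
qed

lemma drift_weights_mem:
  assumes "\<pi> \<in> weights" "\<And>i. 0 < y $ i"
  shows "drift_weights \<pi> y \<in> weights"
proof -
  have "(\<pi> * y) \<bullet> 1 = \<pi> \<bullet> y" by (simp add: inner_vec_def)
  then show ?thesis
    using weights_inner_pos[OF assms] weights_nonneg[OF assms(1)] assms(2)
    by (auto simp: weights_def drift_weights_def less_imp_le)
qed

text \<open>
  The drift map is a projective map of the simplex: the weight of \<open>\<pi>\<^sub>1\<close> in the image of a convex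
  combination is its share of the wealth after the price move.
\<close>

lemma drift_weights_convex_combination:
  assumes "\<pi>\<^sub>1 \<in> weights" "\<pi>\<^sub>2 \<in> weights" "\<And>i. 0 < y $ i" "0 \<le> t" "0 \<le> u" "t + u = 1"
  defines "\<pi> \<equiv> t *\<^sub>R \<pi>\<^sub>1 + u *\<^sub>R \<pi>\<^sub>2"
  shows "drift_weights \<pi> y = (t * (\<pi>\<^sub>1 \<bullet> y) / (\<pi> \<bullet> y)) *\<^sub>R drift_weights \<pi>\<^sub>1 y
                           + (u * (\<pi>\<^sub>2 \<bullet> y) / (\<pi> \<bullet> y)) *\<^sub>R drift_weights \<pi>\<^sub>2 y"
  using weights_inner_pos[OF assms(1,3)] weights_inner_pos[OF assms(2,3)]
  by (simp add: drift_weights_def \<pi>_def scaleR_add_right vec_eq_iff)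
     (simp add: add_divide_distrib distrib_right mult.assoc)


section \<open>Transaction costs\<close>

lemma cost_subadditive: "cost c h (x + y) \<le> cost c h x + cost c h y"
  unfolding cost_def sum.distrib[symmetric]
  by (intro sum_mono) (auto simp: max_def algebra_simps)

lemma cost_scaleR:
  assumes "0 \<le> a"
  shows "cost c h (a *\<^sub>R x) = a * cost c h x"
  unfolding cost_def sum_distrib_left
  by (intro sum.cong refl) (simp add: max_mult_distrib_left assms mult.left_commute)

locale transaction_costs =
  fixes c h :: "real ^ 'n"
  assumes c_range: "\<And>i. 0 \<le> c $ i \<and> c $ i < 1"
    and h_range: "\<And>i. 0 \<le> h $ i \<and> h $ i < 1"
begin

abbreviation "cbar \<equiv> cost_bound c h"
abbreviation "sbar \<equiv> shrink_bound c h"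

lemma le_cbar: "c $ i \<le> cbar" "h $ i \<le> cbar"
proof -
  have "max (c $ i) (h $ i) \<le> cbar" unfolding cost_bound_def by (rule Max_ge) auto
  then show "c $ i \<le> cbar" "h $ i \<le> cbar" by linarith+
qed

lemma cbar_nonneg: "0 \<le> cbar"
  using le_cbar(1)[of undefined] c_range[of undefined] by linarith

lemma cbar_less_one: "cbar < 1"
  unfolding cost_bound_def using c_range h_range by (subst Max_less_iff) auto

lemma sbar_pos: "0 < sbar"
  using cbar_nonneg cbar_less_one by (simp add: shrink_bound_def)

lemma cost_nonneg: "0 \<le> cost c h x"
  unfolding cost_def
proof (intro sum_nonneg)
  fix i
  show "0 \<le> max (c $ i * x $ i) (- h $ i * x $ i)"
    using c_range[of i] h_range[of i]
    by (cases "0 \<le> x $ i") (auto simp: le_max_iff_disj mult_nonneg_nonpos)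
qed

lemma cost_le: "cost c h x \<le> cbar * l1_norm x"
  unfolding cost_def l1_norm_def sum_distrib_left
proof (intro sum_mono)
  fix i
  have "c $ i * x $ i \<le> c $ i * \<bar>x $ i\<bar>" "- h $ i * x $ i \<le> h $ i * \<bar>x $ i\<bar>"
    using c_range[of i] h_range[of i] by (auto simp: abs_if mult_nonneg_nonpos)
  moreover have "c $ i * \<bar>x $ i\<bar> \<le> cbar * \<bar>x $ i\<bar>" "h $ i * \<bar>x $ i\<bar> \<le> cbar * \<bar>x $ i\<bar>"
    by (auto intro!: mult_right_mono le_cbar)
  ultimately show "max (c $ i * x $ i) (- h $ i * x $ i) \<le> cbar * \<bar>x $ i\<bar>"
    by linarith
qed

text \<open>
  The left-hand side of the equation that defines the shrinkage factor grows at least at rate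
  \<open>1 - cbar\<close>: buying a further amount \<open>w' - w\<close> of the target portfolio changes the cost by at
  most \<open>cbar * (w' - w)\<close>.
\<close>

lemma budget_growth:
  assumes "\<pi>' \<in> weights" "w \<le> w'"
  shows "(1 - cbar) * (w' - w) \<le>
    (w' + cost c h (w' *\<^sub>R \<pi>' - \<pi>)) - (w + cost c h (w *\<^sub>R \<pi>' - \<pi>))"
proof -
  have "w *\<^sub>R \<pi>' - \<pi> = (w' *\<^sub>R \<pi>' - \<pi>) + (w - w') *\<^sub>R \<pi>'"
    by (simp add: algebra_simps)
  then have "cost c h (w *\<^sub>R \<pi>' - \<pi>) \<le> cost c h (w' *\<^sub>R \<pi>' - \<pi>) + cost c h ((w - w') *\<^sub>R \<pi>')"
    by (metis cost_subadditive)
  moreover have "cost c h ((w - w') *\<^sub>R \<pi>') \<le> cbar * (w' - w)"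
    using cost_le[of "(w - w') *\<^sub>R \<pi>'"] assms by (simp add: l1_norm_scaled_weights)
  ultimately show ?thesis by (simp add: algebra_simps)
qed

lemma budget_strict_mono:
  assumes "\<pi>' \<in> weights" "w < w'"
  shows "w + cost c h (w *\<^sub>R \<pi>' - \<pi>) < w' + cost c h (w' *\<^sub>R \<pi>' - \<pi>)"
proof -
  have "0 < (1 - cbar) * (w' - w)" using assms cbar_less_one by simp
  then show ?thesis using budget_growth[OF assms(1), of w w' \<pi>] assms(2) by linarith
qed

lemma shrink_exists:
  assumes "\<pi> \<in> weights" "\<pi>' \<in> weights"
  shows "\<exists>w>0. w + cost c h (w *\<^sub>R \<pi>' - \<pi>) = 1"
proof -
  define g where "g w = w + cost c h (w *\<^sub>R \<pi>' - \<pi>)" for w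
  have "g 0 \<le> cbar"
    using cost_le[of "- \<pi>"] weights_l1_norm[OF assms(1)] by (simp add: g_def l1_norm_def)
  then have g0: "g 0 < 1" using cbar_less_one by simp
  have "g 1 \<ge> 1" using cost_nonneg by (simp add: g_def)
  moreover have "continuous_on {0..1} g"
    unfolding g_def cost_def by (intro continuous_intros)
  ultimately obtain w where w: "0 \<le> w" "g w = 1"
    using IVT'[of g 0 1 1] g0 by auto
  moreover have "w \<noteq> 0" using w g0 by auto
  ultimately show ?thesis unfolding g_def by (intro exI[of _ w]) auto
qed

lemma shrink_unique:
  assumes "\<pi> \<in> weights" "\<pi>' \<in> weights"
  shows "\<exists>!w. w > 0 \<and> w + cost c h (w *\<^sub>R \<pi>' - \<pi>) = 1"
  using shrink_exists[OF assms] budget_strict_mono[OF assms(2), of _ _ \<pi>]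
  by (metis linorder_less_linear order_less_irrefl)

lemma
  assumes "\<pi> \<in> weights" "\<pi>' \<in> weights"
  shows shrink_pos: "shrink c h \<pi> \<pi>' > 0"
    and shrink_budget: "shrink c h \<pi> \<pi>' + cost c h (shrink c h \<pi> \<pi>' *\<^sub>R \<pi>' - \<pi>) = 1"
  using theI'[OF shrink_unique[OF assms]] by (auto simp: shrink_def)

lemma shrink_ge_of_budget:
  assumes "\<pi> \<in> weights" "\<pi>' \<in> weights" "w + cost c h (w *\<^sub>R \<pi>' - \<pi>) \<le> 1"
  shows "w \<le> shrink c h \<pi> \<pi>'"
  using budget_strict_mono[OF assms(2), of "shrink c h \<pi> \<pi>'" w \<pi>] shrink_budget[OF assms(1,2)] assms(3)
  by linarith

lemma shrink_le_one: "\<pi> \<in> weights \<Longrightarrow> \<pi>' \<in> weights \<Longrightarrow> shrink c h \<pi> \<pi>' \<le> 1"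
  using shrink_budget[of \<pi> \<pi>'] cost_nonneg[of "shrink c h \<pi> \<pi>' *\<^sub>R \<pi>' - \<pi>"] by linarith

text \<open>
  Selling the old portfolio and buying the new one moves at most \<open>1 + s\<close> in total, so
  \<open>1 - s \<le> cbar * (1 + s)\<close>.
\<close>

lemma shrink_ge_sbar:
  assumes "\<pi> \<in> weights" "\<pi>' \<in> weights"
  shows "sbar \<le> shrink c h \<pi> \<pi>'"
proof -
  let ?s = "shrink c h \<pi> \<pi>'"
  have "l1_norm (?s *\<^sub>R \<pi>' - \<pi>) \<le> ?s + 1"
    using l1_norm_triangle[of "?s *\<^sub>R \<pi>'" \<pi>] shrink_pos[OF assms] assms
    by (simp add: l1_norm_scaled_weights weights_l1_norm)
  then have "cost c h (?s *\<^sub>R \<pi>' - \<pi>) \<le> cbar * (?s + 1)"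
    using cost_le cbar_nonneg by (meson mult_left_mono order_trans)
  then have "1 - cbar \<le> ?s * (1 + cbar)"
    using shrink_budget[OF assms] by (simp add: algebra_simps)
  then show ?thesis using cbar_nonneg by (simp add: shrink_bound_def divide_le_eq)
qed

lemma shrink_le_add:
  assumes "\<pi>\<^sub>1 \<in> weights" "\<pi>\<^sub>2 \<in> weights" "\<pi>' \<in> weights"
  shows "shrink c h \<pi>\<^sub>1 \<pi>' \<le> shrink c h \<pi>\<^sub>2 \<pi>' + cbar / (1 - cbar) * l1_norm (\<pi>\<^sub>1 - \<pi>\<^sub>2)"
proof -
  let ?s1 = "shrink c h \<pi>\<^sub>1 \<pi>'" and ?s2 = "shrink c h \<pi>\<^sub>2 \<pi>'"
  have n: "0 \<le> l1_norm (\<pi>\<^sub>1 - \<pi>\<^sub>2)" by (simp add: l1_norm_def sum_nonneg)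
  show ?thesis
  proof (cases "?s1 \<le> ?s2")
    case True
    moreover have "0 \<le> cbar / (1 - cbar) * l1_norm (\<pi>\<^sub>1 - \<pi>\<^sub>2)"
      using n cbar_nonneg cbar_less_one by simp
    ultimately show ?thesis by linarith
  next
    case False
    have "?s1 *\<^sub>R \<pi>' - \<pi>\<^sub>2 = (?s1 *\<^sub>R \<pi>' - \<pi>\<^sub>1) + (\<pi>\<^sub>1 - \<pi>\<^sub>2)" by simp
    then have "cost c h (?s1 *\<^sub>R \<pi>' - \<pi>\<^sub>2)
        \<le> cost c h (?s1 *\<^sub>R \<pi>' - \<pi>\<^sub>1) + cbar * l1_norm (\<pi>\<^sub>1 - \<pi>\<^sub>2)"
      using cost_subadditive[of c h "?s1 *\<^sub>R \<pi>' - \<pi>\<^sub>1" "\<pi>\<^sub>1 - \<pi>\<^sub>2"] cost_le[of "\<pi>\<^sub>1 - \<pi>\<^sub>2"] by simp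
    then have "(1 - cbar) * (?s1 - ?s2) \<le> cbar * l1_norm (\<pi>\<^sub>1 - \<pi>\<^sub>2)"
      using budget_growth[OF assms(3), of ?s2 ?s1 \<pi>\<^sub>2] False
        shrink_budget[OF assms(1,3)] shrink_budget[OF assms(2,3)] by linarith
    then show ?thesis using cbar_less_one by (simp add: field_simps)
  qed
qed

lemma ln_shrink_le_add:
  assumes "\<pi>\<^sub>1 \<in> weights" "\<pi>\<^sub>2 \<in> weights" "\<pi>' \<in> weights"
  shows "ln (shrink c h \<pi>\<^sub>1 \<pi>')
    \<le> ln (shrink c h \<pi>\<^sub>2 \<pi>') + cbar / ((1 - cbar) * sbar) * l1_norm (\<pi>\<^sub>1 - \<pi>\<^sub>2)"
proof -
  let ?s1 = "shrink c h \<pi>\<^sub>1 \<pi>'" and ?s2 = "shrink c h \<pi>\<^sub>2 \<pi>'"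
  define D where "D = cbar / (1 - cbar) * l1_norm (\<pi>\<^sub>1 - \<pi>\<^sub>2)"
  have D: "0 \<le> D"
    using cbar_nonneg cbar_less_one by (simp add: D_def l1_norm_def sum_nonneg)
  have s: "0 < ?s1" "0 < ?s2" "sbar \<le> ?s2"
    using shrink_pos shrink_ge_sbar assms by auto
  have "ln ?s1 - ln ?s2 = ln (?s1 / ?s2)"
    using s by (simp add: ln_div)
  also have "\<dots> \<le> ?s1 / ?s2 - 1"
    using s by (intro ln_le_minus_one) simp
  also have "\<dots> = (?s1 - ?s2) / ?s2" using s by (simp add: field_simps)
  also have "\<dots> \<le> D / ?s2"
    using shrink_le_add[OF assms] s by (intro divide_right_mono) (auto simp: D_def)
  also have "\<dots> \<le> D / sbar"
    using s D sbar_pos by (intro divide_left_mono) auto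
  finally show ?thesis by (simp add: D_def)
qed

text \<open>
  Mixing two rebalancing trades is a feasible trade for the mixed initial portfolio, because
  the cost is convex.  After scaling to total wealth one, this bounds the shrinkage factor from
  below.
\<close>

lemma shrink_convex_combination:
  assumes "\<pi>\<^sub>1 \<in> weights" "\<pi>\<^sub>2 \<in> weights" "\<rho>\<^sub>1 \<in> weights" "\<rho>\<^sub>2 \<in> weights"
    and "0 \<le> t" "0 \<le> u" "t + u = 1"
  defines "a \<equiv> t * shrink c h \<pi>\<^sub>1 \<rho>\<^sub>1" and "b \<equiv> u * shrink c h \<pi>\<^sub>2 \<rho>\<^sub>2"
  shows "a + b \<le> shrink c h (t *\<^sub>R \<pi>\<^sub>1 + u *\<^sub>R \<pi>\<^sub>2) ((a / (a + b)) *\<^sub>R \<rho>\<^sub>1 + (b / (a + b)) *\<^sub>R \<rho>\<^sub>2)"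
    and "0 \<le> a" "0 \<le> b" "0 < a + b"
proof -
  let ?\<pi> = "t *\<^sub>R \<pi>\<^sub>1 + u *\<^sub>R \<pi>\<^sub>2" and ?\<rho> = "(a / (a + b)) *\<^sub>R \<rho>\<^sub>1 + (b / (a + b)) *\<^sub>R \<rho>\<^sub>2"
  let ?s1 = "shrink c h \<pi>\<^sub>1 \<rho>\<^sub>1" and ?s2 = "shrink c h \<pi>\<^sub>2 \<rho>\<^sub>2"
  have s: "0 < ?s1" "0 < ?s2" using shrink_pos assms by auto
  show ab: "0 \<le> a" "0 \<le> b" using s assms by (auto simp: a_def b_def)
  have "a > 0 \<or> b > 0" using s assms by (auto simp: a_def b_def less_le)
  then show pos: "0 < a + b" using ab by linarith
  have one: "a / (a + b) + b / (a + b) = 1"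
    using pos by (simp flip: add_divide_distrib)
  have \<pi>: "?\<pi> \<in> weights" and \<rho>: "?\<rho> \<in> weights"
    using assms ab pos one by (auto intro!: convexD[OF convex_weights])
  have "(a + b) *\<^sub>R ?\<rho> - ?\<pi> = t *\<^sub>R (?s1 *\<^sub>R \<rho>\<^sub>1 - \<pi>\<^sub>1) + u *\<^sub>R (?s2 *\<^sub>R \<rho>\<^sub>2 - \<pi>\<^sub>2)"
    using pos by (simp add: scaleR_add_right) (simp add: a_def b_def algebra_simps)
  then have "cost c h ((a + b) *\<^sub>R ?\<rho> - ?\<pi>)
      \<le> t * cost c h (?s1 *\<^sub>R \<rho>\<^sub>1 - \<pi>\<^sub>1) + u * cost c h (?s2 *\<^sub>R \<rho>\<^sub>2 - \<pi>\<^sub>2)"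
    using cost_subadditive cost_scaleR assms(5,6) by metis
  also have "\<dots> = t * (1 - ?s1) + u * (1 - ?s2)"
    using shrink_budget[OF assms(1,3)] shrink_budget[OF assms(2,4)]
    by (metis add_diff_cancel_left')
  also have "\<dots> = 1 - (a + b)"
    using assms(7) by (simp add: a_def b_def algebra_simps)
  finally show "a + b \<le> shrink c h ?\<pi> ?\<rho>"
    by (intro shrink_ge_of_budget[OF \<pi> \<rho>]) linarith
qed

end


section \<open>Entropic utility\<close>

context prob_space
begin

definition entropic_integrable :: "real \<Rightarrow> ('a \<Rightarrow> real) \<Rightarrow> bool" where
  "entropic_integrable \<gamma> Z \<longleftrightarrow> integrable M (if \<gamma> = 0 then Z else (\<lambda>\<omega>. exp (\<gamma> * Z \<omega>)))"

lemma expectation_pos: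
  assumes "integrable M f" "\<And>\<omega>. \<omega> \<in> space M \<Longrightarrow> (0::real) < f \<omega>"
  shows "0 < expectation f"
  by (rule expectation_greater[OF assms(1)]) (use assms(2) in auto)

lemma entropic_utility_mono:
  assumes "\<gamma> \<le> 0" "entropic_integrable \<gamma> Z" "entropic_integrable \<gamma> Z'"
    and le: "\<And>\<omega>. \<omega> \<in> space M \<Longrightarrow> Z \<omega> \<le> Z' \<omega>"
  shows "entropic_utility M \<gamma> Z \<le> entropic_utility M \<gamma> Z'"
proof (cases "\<gamma> = 0")
  case True
  then show ?thesis using assms
    by (auto simp: entropic_utility_def entropic_integrable_def intro!: integral_mono)
next
  case False
  then have \<gamma>: "\<gamma> < 0" using assms(1) by simp
  have int: "integrable M (\<lambda>\<omega>. exp (\<gamma> * Z \<omega>))" "integrable M (\<lambda>\<omega>. exp (\<gamma> * Z' \<omega>))"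
    using assms False by (auto simp: entropic_integrable_def)
  have "expectation (\<lambda>\<omega>. exp (\<gamma> * Z' \<omega>)) \<le> expectation (\<lambda>\<omega>. exp (\<gamma> * Z \<omega>))"
    using int \<gamma> le by (intro integral_mono) (auto simp: mult_left_mono_neg)
  moreover have "0 < expectation (\<lambda>\<omega>. exp (\<gamma> * Z' \<omega>))"
    using int by (intro expectation_pos) auto
  ultimately show ?thesis
    using \<gamma> by (simp add: entropic_utility_def divide_right_mono_neg)
qed

lemma entropic_integrable_add:
  assumes "entropic_integrable \<gamma> Z"
  shows "entropic_integrable \<gamma> (\<lambda>\<omega>. Z \<omega> + k)"
  using assms by (auto simp: entropic_integrable_def distrib_left exp_add)

lemma entropic_utility_add:
  assumes "entropic_integrable \<gamma> Z"
  shows "entropic_utility M \<gamma> (\<lambda>\<omega>. Z \<omega> + k) = entropic_utility M \<gamma> Z + k"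
proof (cases "\<gamma> = 0")
  case True
  then show ?thesis using assms prob_space
    by (simp add: entropic_utility_def entropic_integrable_def)
next
  case False
  then have int: "integrable M (\<lambda>\<omega>. exp (\<gamma> * Z \<omega>))"
    using assms by (simp add: entropic_integrable_def)
  have "0 < expectation (\<lambda>\<omega>. exp (\<gamma> * Z \<omega>))"
    using int by (intro expectation_pos) auto
  then have "ln (expectation (\<lambda>\<omega>. exp (\<gamma> * Z \<omega>)) * exp (\<gamma> * k))
      = ln (expectation (\<lambda>\<omega>. exp (\<gamma> * Z \<omega>))) + \<gamma> * k"
    by (simp add: ln_mult)
  then show ?thesis
    using False by (simp add: entropic_utility_def distrib_left exp_add add_divide_distrib)
qed

text \<open>
  The certainty equivalent \<open>exp \<mu>[ln X]\<close> is a concave function of the random wealth \<open>X\<close>.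
  Divide both wealths by their certainty equivalents.  Convexity of \<open>exp\<close> bounds the logarithm
  of a weighted average from below by the weighted average of the logarithms, and, applied once
  more, bounds the expected utility of the latter by that of its two terms.
\<close>

lemma certainty_equivalent_concave:
  assumes "\<gamma> \<le> 0" and int: "entropic_integrable \<gamma> Z\<^sub>1" "entropic_integrable \<gamma> Z\<^sub>2" "entropic_integrable \<gamma> Z"
    and t: "0 \<le> t" "0 \<le> u" "t + u = 1"
    and ge: "\<And>\<omega>. \<omega> \<in> space M \<Longrightarrow> t * exp (Z\<^sub>1 \<omega>) + u * exp (Z\<^sub>2 \<omega>) \<le> exp (Z \<omega>)"
  shows "t * exp (entropic_utility M \<gamma> Z\<^sub>1) + u * exp (entropic_utility M \<gamma> Z\<^sub>2)
    \<le> exp (entropic_utility M \<gamma> Z)"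
proof -
  define m1 m2 where "m1 = entropic_utility M \<gamma> Z\<^sub>1" and "m2 = entropic_utility M \<gamma> Z\<^sub>2"
  define C where "C = t * exp m1 + u * exp m2"
  have C: "0 < C"
  proof (cases "t = 0")
    case False
    then show ?thesis unfolding C_def using t by (intro add_pos_nonneg) auto
  qed (use t in \<open>simp add: C_def\<close>)
  define \<alpha> \<beta> where "\<alpha> = t * exp m1 / C" and "\<beta> = u * exp m2 / C"
  have ab: "0 \<le> \<alpha>" "0 \<le> \<beta>" "\<alpha> + \<beta> = 1"
    using C t by (auto simp: \<alpha>_def \<beta>_def C_def simp flip: add_divide_distrib)
  have exp_conv: "exp (\<alpha> * x + \<beta> * y) \<le> \<alpha> * exp x + \<beta> * exp y" for x y :: real
    using exp_convex ab by (simp add: convex_on_def)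
  \<comment> \<open>The normalised logarithmic wealths \<open>Z\<^sub>i - m\<^sub>i\<close> have utility zero.\<close>
  have key: "\<alpha> * (Z\<^sub>1 \<omega> - m1) + \<beta> * (Z\<^sub>2 \<omega> - m2) \<le> Z \<omega> - ln C" if "\<omega> \<in> space M" for \<omega>
  proof -
    have "exp (\<alpha> * (Z\<^sub>1 \<omega> - m1) + \<beta> * (Z\<^sub>2 \<omega> - m2)) \<le> \<alpha> * exp (Z\<^sub>1 \<omega> - m1) + \<beta> * exp (Z\<^sub>2 \<omega> - m2)"
      by (rule exp_conv)
    also have "\<dots> = (t * exp (Z\<^sub>1 \<omega>) + u * exp (Z\<^sub>2 \<omega>)) / C"
      by (simp add: \<alpha>_def \<beta>_def exp_diff add_divide_distrib)
    also have "\<dots> \<le> exp (Z \<omega>) / C"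
      using ge[OF that] C by (intro divide_right_mono) auto
    also have "\<dots> = exp (Z \<omega> - ln C)" using C by (simp add: exp_diff)
    finally show ?thesis by simp
  qed
  have "ln C \<le> entropic_utility M \<gamma> Z"
  proof (cases "\<gamma> = 0")
    case True
    then have i: "integrable M Z\<^sub>1" "integrable M Z\<^sub>2" "integrable M Z"
      using int by (auto simp: entropic_integrable_def)
    have "expectation (\<lambda>\<omega>. \<alpha> * (Z\<^sub>1 \<omega> - m1) + \<beta> * (Z\<^sub>2 \<omega> - m2)) \<le> expectation (\<lambda>\<omega>. Z \<omega> - ln C)"
      using i key by (intro integral_mono) auto
    then show ?thesis
      using i True by (simp add: m1_def m2_def entropic_utility_def prob_space)
  next
    case False
    then have \<gamma>: "\<gamma> < 0" using assms(1) by simp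
    have i: "integrable M (\<lambda>\<omega>. exp (\<gamma> * Z\<^sub>1 \<omega>))" "integrable M (\<lambda>\<omega>. exp (\<gamma> * Z\<^sub>2 \<omega>))"
      "integrable M (\<lambda>\<omega>. exp (\<gamma> * Z \<omega>))"
      using int False by (auto simp: entropic_integrable_def)
    have E: "expectation (\<lambda>\<omega>. exp (\<gamma> * Z\<^sub>1 \<omega>)) = exp (\<gamma> * m1)"
      "expectation (\<lambda>\<omega>. exp (\<gamma> * Z\<^sub>2 \<omega>)) = exp (\<gamma> * m2)"
      using expectation_pos[OF i(1)] expectation_pos[OF i(2)] False
      by (simp_all add: m1_def m2_def entropic_utility_def)
    have "exp (\<gamma> * Z \<omega>) / exp (\<gamma> * ln C)
        \<le> \<alpha> * (exp (\<gamma> * Z\<^sub>1 \<omega>) / exp (\<gamma> * m1)) + \<beta> * (exp (\<gamma> * Z\<^sub>2 \<omega>) / exp (\<gamma> * m2))"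
      if "\<omega> \<in> space M" for \<omega>
    proof -
      have "\<gamma> * (Z \<omega> - ln C) \<le> \<gamma> * (\<alpha> * (Z\<^sub>1 \<omega> - m1) + \<beta> * (Z\<^sub>2 \<omega> - m2))"
        using key[OF that] \<gamma> by (simp add: mult_left_mono_neg)
      also have "\<dots> = \<alpha> * (\<gamma> * (Z\<^sub>1 \<omega> - m1)) + \<beta> * (\<gamma> * (Z\<^sub>2 \<omega> - m2))"
        by (simp add: algebra_simps)
      finally have "exp (\<gamma> * (Z \<omega> - ln C))
          \<le> \<alpha> * exp (\<gamma> * (Z\<^sub>1 \<omega> - m1)) + \<beta> * exp (\<gamma> * (Z\<^sub>2 \<omega> - m2))"
        using exp_conv by (meson exp_le_cancel_iff order_trans)
      then show ?thesis by (simp add: right_diff_distrib exp_diff)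
    qed
    then have "expectation (\<lambda>\<omega>. exp (\<gamma> * Z \<omega>) / exp (\<gamma> * ln C))
        \<le> expectation (\<lambda>\<omega>. \<alpha> * (exp (\<gamma> * Z\<^sub>1 \<omega>) / exp (\<gamma> * m1))
              + \<beta> * (exp (\<gamma> * Z\<^sub>2 \<omega>) / exp (\<gamma> * m2)))"
      using i by (intro integral_mono) auto
    also have "\<dots> = 1" using i E ab by simp
    finally have le: "expectation (\<lambda>\<omega>. exp (\<gamma> * Z \<omega>)) \<le> exp (\<gamma> * ln C)"
      by (simp add: divide_le_eq)
    have pos: "0 < expectation (\<lambda>\<omega>. exp (\<gamma> * Z \<omega>))"
      using expectation_pos[OF i(3)] by simp
    have "ln (expectation (\<lambda>\<omega>. exp (\<gamma> * Z \<omega>))) \<le> \<gamma> * ln C"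
      using le pos by (metis exp_le_cancel_iff exp_ln)
    then have "ln C \<le> ln (expectation (\<lambda>\<omega>. exp (\<gamma> * Z \<omega>))) / \<gamma>"
      using \<gamma> by (simp add: neg_le_divide_eq mult.commute)
    then show ?thesis
      using False by (simp add: entropic_utility_def)
  qed
  then have "exp (ln C) \<le> exp (entropic_utility M \<gamma> Z)" by simp
  then have "C \<le> exp (entropic_utility M \<gamma> Z)" using C by (simp only: exp_ln)
  then show ?thesis by (simp only: C_def m1_def m2_def)
qed

end


section \<open>Continuation utility of a portfolio\<close>

lemma borel_measurable_vec_component:
  fixes f :: "'w \<Rightarrow> real ^ 'n"
  assumes "f \<in> borel_measurable M"
  shows "(\<lambda>\<omega>. f \<omega> $ i) \<in> borel_measurable M"
  by (rule borel_measurable_continuous_on[OF _ assms]) (intro continuous_intros)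

locale return_model = prob_space M
  for M :: "'w measure" +
  fixes R :: "'w \<Rightarrow> real ^ 'n" and \<gamma> :: real
  assumes R_measurable [measurable]: "R \<in> borel_measurable M"
    and R_pos: "\<And>\<omega> i. \<omega> \<in> space M \<Longrightarrow> 0 < R \<omega> $ i"
    and integrable_exp_Min: "\<And>\<delta>. \<delta> < 0 \<Longrightarrow> integrable M (\<lambda>\<omega>. exp (\<delta> * Min (range (\<lambda>i. ln (R \<omega> $ i)))))"
    and integrable_Max: "integrable M (\<lambda>\<omega>. Max (range (\<lambda>i. ln (R \<omega> $ i))))"
    and \<gamma>_nonpos: "\<gamma> \<le> 0"
begin

definition min_log_return :: "'w \<Rightarrow> real" where "min_log_return \<omega> = Min (range (\<lambda>i. ln (R \<omega> $ i)))"
definition max_log_return :: "'w \<Rightarrow> real" where "max_log_return \<omega> = Max (range (\<lambda>i. ln (R \<omega> $ i)))"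

definition growth :: "(real ^ 'n \<Rightarrow> real) \<Rightarrow> real ^ 'n \<Rightarrow> 'w \<Rightarrow> real" where
  "growth v \<pi> \<omega> = ln (\<pi> \<bullet> R \<omega>) + v (drift_weights \<pi> (R \<omega>))"

definition utility :: "(real ^ 'n \<Rightarrow> real) \<Rightarrow> real ^ 'n \<Rightarrow> real" where
  "utility v \<pi> = entropic_utility M \<gamma> (growth v \<pi>)"

lemma R_component_measurable [measurable]: "(\<lambda>\<omega>. R \<omega> $ i) \<in> borel_measurable M"
  by (rule borel_measurable_vec_component[OF R_measurable])

lemma min_log_return_measurable [measurable]: "min_log_return \<in> borel_measurable M"
  unfolding min_log_return_def by measurable

lemma max_log_return_measurable [measurable]: "max_log_return \<in> borel_measurable M"
  unfolding max_log_return_def by measurable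

lemma min_le_max_log_return: "min_log_return \<omega> \<le> max_log_return \<omega>"
proof -
  have "min_log_return \<omega> \<le> ln (R \<omega> $ undefined)" unfolding min_log_return_def by simp
  also have "\<dots> \<le> max_log_return \<omega>" unfolding max_log_return_def by simp
  finally show ?thesis .
qed

text \<open>
  The utility is defined for every \<open>\<gamma> \<le> 0\<close> on variables that stay between the worst and the
  best logarithmic return, up to a constant; for \<open>\<gamma> = 0\<close> the lower bound is integrable because
  \<open>- x \<le> exp (- x)\<close>.
\<close>

lemma entropic_integrableI:
  assumes [measurable]: "Z \<in> borel_measurable M"
    and bounds: "\<And>\<omega>. \<omega> \<in> space M \<Longrightarrow> min_log_return \<omega> - K \<le> Z \<omega> \<and> Z \<omega> \<le> max_log_return \<omega> + K"
  shows "entropic_integrable \<gamma> Z"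
proof (cases "\<gamma> = 0")
  case True
  have e: "integrable M (\<lambda>\<omega>. exp (- min_log_return \<omega>))"
    using integrable_exp_Min[of "- 1"] by (simp add: min_log_return_def)
  have max_log_return: "integrable M max_log_return" unfolding max_log_return_def by (rule integrable_Max)
  have "integrable M (\<lambda>\<omega>. exp (- min_log_return \<omega>) + \<bar>max_log_return \<omega>\<bar> + \<bar>K\<bar>)"
    using e max_log_return by auto
  then have "integrable M Z"
  proof (rule Bochner_Integration.integrable_bound)
    show "AE \<omega> in M. norm (Z \<omega>) \<le> norm (exp (- min_log_return \<omega>) + \<bar>max_log_return \<omega>\<bar> + \<bar>K\<bar>)"
    proof (rule AE_I2)
      fix \<omega> assume "\<omega> \<in> space M"
      moreover have "- min_log_return \<omega> \<le> exp (- min_log_return \<omega>)" "0 \<le> exp (- min_log_return \<omega>)"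
        using exp_ge_add_one_self[of "- min_log_return \<omega>"] by auto
      ultimately show "norm (Z \<omega>) \<le> norm (exp (- min_log_return \<omega>) + \<bar>max_log_return \<omega>\<bar> + \<bar>K\<bar>)"
        using bounds[of \<omega>] unfolding real_norm_def by arith
    qed
  qed simp
  then show ?thesis using True by (simp add: entropic_integrable_def)
next
  case False
  then have \<gamma>: "\<gamma> < 0" using \<gamma>_nonpos by simp
  have "integrable M (\<lambda>\<omega>. exp (\<gamma> * min_log_return \<omega>) * exp (- \<gamma> * K))"
    using integrable_exp_Min[OF \<gamma>] by (simp add: min_log_return_def)
  then have "integrable M (\<lambda>\<omega>. exp (\<gamma> * Z \<omega>))"
  proof (rule Bochner_Integration.integrable_bound)
    show "AE \<omega> in M. norm (exp (\<gamma> * Z \<omega>)) \<le> norm (exp (\<gamma> * min_log_return \<omega>) * exp (- \<gamma> * K))"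
    proof (rule AE_I2)
      fix \<omega> assume "\<omega> \<in> space M"
      then have "\<gamma> * Z \<omega> \<le> \<gamma> * (min_log_return \<omega> - K)"
        using bounds[of \<omega>] \<gamma> by (simp add: mult_left_mono_neg)
      then show "norm (exp (\<gamma> * Z \<omega>)) \<le> norm (exp (\<gamma> * min_log_return \<omega>) * exp (- \<gamma> * K))"
        by (simp add: algebra_simps flip: exp_add)
    qed
  qed simp
  then show ?thesis using False by (simp add: entropic_integrable_def)
qed

lemma weights_ln_inner_bounds:
  assumes "\<pi> \<in> weights" "\<omega> \<in> space M"
  shows "min_log_return \<omega> \<le> ln (\<pi> \<bullet> R \<omega>)" "ln (\<pi> \<bullet> R \<omega>) \<le> max_log_return \<omega>"
proof -
  have pos: "0 < \<pi> \<bullet> R \<omega>" using weights_inner_pos[OF assms(1)] R_pos[OF assms(2)] by auto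
  have "exp (min_log_return \<omega>) \<le> R \<omega> $ i" "R \<omega> $ i \<le> exp (max_log_return \<omega>)" for i
  proof -
    have "min_log_return \<omega> \<le> ln (R \<omega> $ i)" "ln (R \<omega> $ i) \<le> max_log_return \<omega>"
      unfolding min_log_return_def max_log_return_def by simp_all
    then have "exp (min_log_return \<omega>) \<le> exp (ln (R \<omega> $ i))" "exp (ln (R \<omega> $ i)) \<le> exp (max_log_return \<omega>)" by simp_all
    then show "exp (min_log_return \<omega>) \<le> R \<omega> $ i" "R \<omega> $ i \<le> exp (max_log_return \<omega>)"
      using R_pos[OF assms(2), of i] by simp_all
  qed
  then have "exp (min_log_return \<omega>) \<le> \<pi> \<bullet> R \<omega>" "\<pi> \<bullet> R \<omega> \<le> exp (max_log_return \<omega>)"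
    using weights_inner_ge[OF assms(1)] weights_inner_le[OF assms(1)] by auto
  then show "min_log_return \<omega> \<le> ln (\<pi> \<bullet> R \<omega>)" "ln (\<pi> \<bullet> R \<omega>) \<le> max_log_return \<omega>"
    using pos by (metis exp_le_cancel_iff exp_ln)+
qed

lemma drift_R_mem: "\<pi> \<in> weights \<Longrightarrow> \<omega> \<in> space M \<Longrightarrow> drift_weights \<pi> (R \<omega>) \<in> weights"
  using drift_weights_mem R_pos by blast

lemma growth_measurable:
  assumes "continuous_on weights v" "\<pi> \<in> weights"
  shows "growth v \<pi> \<in> borel_measurable M"
proof -
  \<comment> \<open>Replace \<open>v\<close> by a continuous extension to the whole space.\<close>
  define v' where "v' = v \<circ> closest_point weights"
  have closed: "closed (weights :: (real ^ 'n) set)" by (simp add: compact_imp_closed compact_weights)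
  have "continuous_on UNIV v'"
    unfolding v'_def
    using closest_point_in_set[OF closed weights_nonempty]
    by (intro continuous_on_compose continuous_on_closest_point convex_weights closed weights_nonempty
        continuous_on_subset[OF assms(1)]) auto
  then have v'_meas [measurable]: "v' \<in> borel_measurable borel"
    by (rule borel_measurable_continuous_onI)
  have inner_meas [measurable]: "(\<lambda>\<omega>. \<pi> \<bullet> R \<omega>) \<in> borel_measurable M" by measurable
  have mult_meas [measurable]: "(\<lambda>\<omega>. \<pi> * R \<omega>) \<in> borel_measurable M"
    by (rule borel_measurable_continuous_on[OF _ R_measurable])
      (simp add: times_vec_def, intro continuous_intros)
  have "(\<lambda>\<omega>. ln (\<pi> \<bullet> R \<omega>) + v' (drift_weights \<pi> (R \<omega>))) \<in> borel_measurable M"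
    unfolding drift_weights_def by measurable
  moreover have "growth v \<pi> \<omega> = ln (\<pi> \<bullet> R \<omega>) + v' (drift_weights \<pi> (R \<omega>))"
    if "\<omega> \<in> space M" for \<omega>
    using drift_R_mem[OF assms(2) that] by (simp add: growth_def v'_def closest_point_self)
  ultimately show ?thesis by (subst measurable_cong) auto
qed

lemma growth_bounds:
  assumes "\<And>\<pi>. \<pi> \<in> weights \<Longrightarrow> \<bar>v \<pi>\<bar> \<le> K" "\<pi> \<in> weights" "\<omega> \<in> space M"
  shows "min_log_return \<omega> - K \<le> growth v \<pi> \<omega> \<and> growth v \<pi> \<omega> \<le> max_log_return \<omega> + K"
  using weights_ln_inner_bounds[OF assms(2,3)] assms(1)[OF drift_R_mem[OF assms(2,3)]]
  by (simp add: growth_def abs_le_iff)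

lemma growth_entropic_integrable:
  assumes "continuous_on weights v" "\<pi> \<in> weights"
  shows "entropic_integrable \<gamma> (growth v \<pi>)"
proof -
  obtain K where "\<And>\<pi>. \<pi> \<in> weights \<Longrightarrow> \<bar>v \<pi>\<bar> \<le> K"
    using continuous_on_weights_bounded[OF assms(1)] by metis
  then show ?thesis
    using growth_measurable[OF assms] growth_bounds assms(2)
    by (intro entropic_integrableI[where K = K]) auto
qed

lemma utility_le_add:
  assumes "continuous_on weights v" "continuous_on weights v'" "\<pi> \<in> weights"
    and "\<And>\<pi>. \<pi> \<in> weights \<Longrightarrow> v \<pi> \<le> v' \<pi> + k"
  shows "utility v \<pi> \<le> utility v' \<pi> + k"
proof -
  have "utility v \<pi> \<le> entropic_utility M \<gamma> (\<lambda>\<omega>. growth v' \<pi> \<omega> + k)"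
    unfolding utility_def
    using assms(4) drift_R_mem[OF assms(3)]
    by (intro entropic_utility_mono \<gamma>_nonpos growth_entropic_integrable entropic_integrable_add assms)
       (auto simp: growth_def)
  then show ?thesis
    using growth_entropic_integrable[OF assms(2,3)] by (simp add: entropic_utility_add utility_def)
qed

lemma utility_bounded_above:
  assumes "continuous_on weights v"
  obtains B where "\<And>\<pi>. \<pi> \<in> weights \<Longrightarrow> utility v \<pi> \<le> B"
proof -
  obtain K where K: "0 \<le> K" "\<And>\<pi>. \<pi> \<in> weights \<Longrightarrow> \<bar>v \<pi>\<bar> \<le> K"
    using continuous_on_weights_bounded[OF assms(1)] by metis
  have "min_log_return \<omega> - K \<le> max_log_return \<omega> + K" for \<omega>
    using min_le_max_log_return[of \<omega>] K(1) by linarith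
  then have "entropic_integrable \<gamma> (\<lambda>\<omega>. max_log_return \<omega> + K)"
    by (intro entropic_integrableI[where K = K]) auto
  then have "utility v \<pi> \<le> entropic_utility M \<gamma> (\<lambda>\<omega>. max_log_return \<omega> + K)" if "\<pi> \<in> weights" for \<pi>
    unfolding utility_def using growth_bounds[OF K(2) that] that assms
    by (intro entropic_utility_mono \<gamma>_nonpos growth_entropic_integrable) auto
  then show ?thesis by (rule that)
qed

text \<open>
  The terminal wealth \<open>exp (growth v \<pi>)\<close> is the lift of \<open>v\<close> applied to the portfolio after the
  price move, that is, the perspective of \<open>exp \<circ> v\<close> composed with a linear map.  So it is
  concave in the portfolio whenever \<open>exp \<circ> v\<close> is.
\<close>

lemma growth_concave:
  assumes conc: "concave_on weights (\<lambda>\<pi>. exp (v \<pi>))"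
    and "\<pi>\<^sub>1 \<in> weights" "\<pi>\<^sub>2 \<in> weights" "0 \<le> t" "0 \<le> u" "t + u = 1" "\<omega> \<in> space M"
  shows "t * exp (growth v \<pi>\<^sub>1 \<omega>) + u * exp (growth v \<pi>\<^sub>2 \<omega>)
    \<le> exp (growth v (t *\<^sub>R \<pi>\<^sub>1 + u *\<^sub>R \<pi>\<^sub>2) \<omega>)"
proof -
  let ?y = "R \<omega>" and ?\<pi> = "t *\<^sub>R \<pi>\<^sub>1 + u *\<^sub>R \<pi>\<^sub>2"
  define D where "D = drift_weights ?\<pi> ?y"
  define D1 where "D1 = drift_weights \<pi>\<^sub>1 ?y"
  define D2 where "D2 = drift_weights \<pi>\<^sub>2 ?y"
  define p where "p = t * (\<pi>\<^sub>1 \<bullet> ?y) / (?\<pi> \<bullet> ?y)"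
  define q where "q = u * (\<pi>\<^sub>2 \<bullet> ?y) / (?\<pi> \<bullet> ?y)"
  have \<pi>: "?\<pi> \<in> weights" using assms by (intro convexD[OF convex_weights]) auto
  have pos: "0 < \<pi>\<^sub>1 \<bullet> ?y" "0 < \<pi>\<^sub>2 \<bullet> ?y" "0 < ?\<pi> \<bullet> ?y"
    using weights_inner_pos R_pos[OF assms(7)] assms(2,3) \<pi> by auto
  have mem: "D1 \<in> weights" "D2 \<in> weights"
    using drift_R_mem assms by (auto simp: D1_def D2_def)
  have "D = p *\<^sub>R D1 + q *\<^sub>R D2"
    unfolding D_def D1_def D2_def p_def q_def
    by (rule drift_weights_convex_combination) (use assms R_pos in auto)
  moreover have pq: "0 \<le> p" "0 \<le> q" using assms pos by (auto simp: p_def q_def)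
  moreover have "p + q = 1"
    using pos(3) by (simp add: p_def q_def inner_add_left flip: add_divide_distrib)
  ultimately have "p * exp (v D1) + q * exp (v D2) \<le> exp (v D)"
    using conc mem unfolding concave_on_iff by blast
  then have "(?\<pi> \<bullet> ?y) * (p * exp (v D1) + q * exp (v D2)) \<le> (?\<pi> \<bullet> ?y) * exp (v D)"
    using pos(3) by (intro mult_left_mono) auto
  moreover have "(?\<pi> \<bullet> ?y) * (p * exp (v D1) + q * exp (v D2))
      = t * ((\<pi>\<^sub>1 \<bullet> ?y) * exp (v D1)) + u * ((\<pi>\<^sub>2 \<bullet> ?y) * exp (v D2))"
    using pos(3) by (simp add: p_def q_def distrib_left)
  moreover have "exp (growth v \<pi>\<^sub>1 \<omega>) = (\<pi>\<^sub>1 \<bullet> ?y) * exp (v D1)"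
    "exp (growth v \<pi>\<^sub>2 \<omega>) = (\<pi>\<^sub>2 \<bullet> ?y) * exp (v D2)"
    "exp (growth v ?\<pi> \<omega>) = (?\<pi> \<bullet> ?y) * exp (v D)"
    using pos by (simp_all add: growth_def exp_add D_def D1_def D2_def)
  ultimately show ?thesis by simp
qed

lemma utility_concave:
  assumes "continuous_on weights v" and "concave_on weights (\<lambda>\<pi>. exp (v \<pi>))"
  shows "concave_on weights (\<lambda>\<pi>. exp (utility v \<pi>))"
  unfolding concave_on_iff
proof (intro conjI ballI allI impI convex_weights)
  fix \<pi>\<^sub>1 \<pi>\<^sub>2 :: "real ^ 'n" and t u :: real
  assume a: "\<pi>\<^sub>1 \<in> weights" "\<pi>\<^sub>2 \<in> weights" "0 \<le> t" "0 \<le> u" "t + u = 1"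
  have "t *\<^sub>R \<pi>\<^sub>1 + u *\<^sub>R \<pi>\<^sub>2 \<in> weights" using a by (intro convexD[OF convex_weights]) auto
  then show "t * exp (utility v \<pi>\<^sub>1) + u * exp (utility v \<pi>\<^sub>2)
      \<le> exp (utility v (t *\<^sub>R \<pi>\<^sub>1 + u *\<^sub>R \<pi>\<^sub>2))"
    unfolding utility_def using a assms
    by (intro certainty_equivalent_concave \<gamma>_nonpos growth_entropic_integrable growth_concave) auto
qed

end


section \<open>The Bellman operator\<close>

text \<open>
  This turns an inequality between concave combinations of exponentials into one for suprema,
  one supremum at a time; the term \<open>m\<close> stands for the other summand.
\<close>

lemma scaled_exp_SUP_le:
  fixes f :: "'b \<Rightarrow> real"
  assumes "A \<noteq> {}" "0 \<le> t" and le: "\<And>a. a \<in> A \<Longrightarrow> t * exp (f a) + m \<le> K"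
  shows "t * exp (SUP a\<in>A. f a) + m \<le> K"
proof (cases "t = 0")
  case True
  then show ?thesis using assms by auto
next
  case False
  then have t: "0 < t" using assms(2) by simp
  have b: "exp (f a) \<le> (K - m) / t" if "a \<in> A" for a
    using le[OF that] t by (simp add: field_simps)
  then have pos: "0 < (K - m) / t"
    using assms(1) by (metis all_not_in_conv exp_gt_zero less_le_trans)
  have "f a \<le> ln ((K - m) / t)" if "a \<in> A" for a
    using b[OF that] pos by (metis exp_le_cancel_iff exp_ln)
  then have "(SUP a\<in>A. f a) \<le> ln ((K - m) / t)"
    by (intro cSUP_least assms)
  then have "exp (SUP a\<in>A. f a) \<le> (K - m) / t"
    using pos by (metis exp_le_cancel_iff exp_ln)
  then show ?thesis using t by (simp add: field_simps)
qed

locale bellman = transaction_costs c h + return_model M R \<gamma>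
  for c h :: "real ^ 'n" and M :: "'w measure" and R :: "'w \<Rightarrow> real ^ 'n" and \<gamma> :: real
begin

definition bellman_op :: "(real ^ 'n \<Rightarrow> real) \<Rightarrow> real ^ 'n \<Rightarrow> real" where
  "bellman_op v \<pi> = (SUP \<pi>'\<in>weights. ln (shrink c h \<pi> \<pi>') + utility v \<pi>')"

lemma ln_shrink_nonpos: "\<pi> \<in> weights \<Longrightarrow> \<pi>' \<in> weights \<Longrightarrow> ln (shrink c h \<pi> \<pi>') \<le> 0"
  using shrink_le_one shrink_pos by simp

lemma bellman_bdd_above:
  assumes "continuous_on weights v" "\<pi> \<in> weights"
  shows "bdd_above ((\<lambda>\<pi>'. ln (shrink c h \<pi> \<pi>') + utility v \<pi>') ` weights)"
proof -
  obtain B where "\<And>\<pi>. \<pi> \<in> weights \<Longrightarrow> utility v \<pi> \<le> B"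
    using utility_bounded_above[OF assms(1)] by metis
  then show ?thesis
    using ln_shrink_nonpos[OF assms(2)] by (intro bdd_aboveI2[where M = B]) (metis add_mono add_0)
qed

lemma bellman_ge:
  assumes "continuous_on weights v" "\<pi> \<in> weights" "\<pi>' \<in> weights"
  shows "ln (shrink c h \<pi> \<pi>') + utility v \<pi>' \<le> bellman_op v \<pi>"
  unfolding bellman_op_def by (intro cSUP_upper bellman_bdd_above assms)

lemma bellman_le:
  assumes "\<And>\<pi>'. \<pi>' \<in> weights \<Longrightarrow> ln (shrink c h \<pi> \<pi>') + utility v \<pi>' \<le> b"
  shows "bellman_op v \<pi> \<le> b"
  unfolding bellman_op_def by (intro cSUP_least weights_nonempty assms)

lemma bellman_le_add:
  assumes "continuous_on weights v" "continuous_on weights v'" "\<pi> \<in> weights"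
    and "\<And>\<pi>. \<pi> \<in> weights \<Longrightarrow> v \<pi> \<le> v' \<pi> + k"
  shows "bellman_op v \<pi> \<le> bellman_op v' \<pi> + k"
proof (rule bellman_le)
  fix \<pi>' :: "real ^ 'n" assume "\<pi>' \<in> weights"
  then show "ln (shrink c h \<pi> \<pi>') + utility v \<pi>' \<le> bellman_op v' \<pi> + k"
    using bellman_ge[OF assms(2,3)] utility_le_add[OF assms(1,2) _ assms(4)]
    by (smt (verit))
qed

lemma bellman_nonexpansive:
  assumes "continuous_on weights v" "continuous_on weights v'" "\<pi> \<in> weights"
    and "\<And>\<pi>. \<pi> \<in> weights \<Longrightarrow> \<bar>v \<pi> - v' \<pi>\<bar> \<le> k"
  shows "\<bar>bellman_op v \<pi> - bellman_op v' \<pi>\<bar> \<le> k"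
proof -
  have "v \<pi> \<le> v' \<pi> + k \<and> v' \<pi> \<le> v \<pi> + k" if "\<pi> \<in> weights" for \<pi>
    using assms(4)[OF that] by linarith
  then show ?thesis
    using bellman_le_add[OF assms(1,2,3), of k] bellman_le_add[OF assms(2,1,3), of k]
    by (simp add: abs_le_iff)
qed

lemma bellman_add:
  assumes "continuous_on weights v" "\<pi> \<in> weights"
  shows "bellman_op (\<lambda>\<pi>. v \<pi> + k) \<pi> = bellman_op v \<pi> + k"
proof (rule antisym)
  have c: "continuous_on weights (\<lambda>\<pi>. v \<pi> + k)" by (intro continuous_intros assms)
  show "bellman_op (\<lambda>\<pi>. v \<pi> + k) \<pi> \<le> bellman_op v \<pi> + k"
    by (rule bellman_le_add[OF c assms]) simp
  show "bellman_op v \<pi> + k \<le> bellman_op (\<lambda>\<pi>. v \<pi> + k) \<pi>"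
    using bellman_le_add[OF assms(1) c assms(2), of "- k"] by simp
qed

text \<open>
  The regularity of \<open>bellman_op v\<close> does not depend on \<open>v\<close>: the initial portfolio enters only
  through the shrinkage factor.
\<close>

lemma bellman_lipschitz:
  assumes "continuous_on weights v" "\<pi>\<^sub>1 \<in> weights" "\<pi>\<^sub>2 \<in> weights"
  shows "\<bar>bellman_op v \<pi>\<^sub>1 - bellman_op v \<pi>\<^sub>2\<bar> \<le> cbar / ((1 - cbar) * sbar) * l1_norm (\<pi>\<^sub>1 - \<pi>\<^sub>2)"
proof -
  have le: "bellman_op v \<pi>\<^sub>1 \<le> bellman_op v \<pi>\<^sub>2 + cbar / ((1 - cbar) * sbar) * l1_norm (\<pi>\<^sub>1 - \<pi>\<^sub>2)"
    if "\<pi>\<^sub>1 \<in> weights" "\<pi>\<^sub>2 \<in> weights" for \<pi>\<^sub>1 \<pi>\<^sub>2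
  proof (rule bellman_le)
    fix \<pi>' :: "real ^ 'n" assume "\<pi>' \<in> weights"
    then show "ln (shrink c h \<pi>\<^sub>1 \<pi>') + utility v \<pi>'
        \<le> bellman_op v \<pi>\<^sub>2 + cbar / ((1 - cbar) * sbar) * l1_norm (\<pi>\<^sub>1 - \<pi>\<^sub>2)"
      using bellman_ge[OF assms(1) that(2)] ln_shrink_le_add[OF that] by (smt (verit))
  qed
  have "l1_norm (\<pi>\<^sub>2 - \<pi>\<^sub>1) = l1_norm (\<pi>\<^sub>1 - \<pi>\<^sub>2)"
    by (simp add: l1_norm_def abs_minus_commute)
  then show ?thesis using le[OF assms(2,3)] le[OF assms(3,2)] by (simp add: abs_le_iff)
qed

lemma bellman_oscillation:
  assumes "continuous_on weights v" "\<pi>\<^sub>1 \<in> weights" "\<pi>\<^sub>2 \<in> weights"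
  shows "bellman_op v \<pi>\<^sub>1 \<le> bellman_op v \<pi>\<^sub>2 + ln (1 / sbar)"
proof (rule bellman_le)
  fix \<pi>' :: "real ^ 'n" assume \<pi>': "\<pi>' \<in> weights"
  have "ln sbar \<le> ln (shrink c h \<pi>\<^sub>2 \<pi>')"
    using shrink_ge_sbar[OF assms(3) \<pi>'] shrink_pos[OF assms(3) \<pi>'] sbar_pos by simp
  then show "ln (shrink c h \<pi>\<^sub>1 \<pi>') + utility v \<pi>' \<le> bellman_op v \<pi>\<^sub>2 + ln (1 / sbar)"
    using bellman_ge[OF assms(1,3) \<pi>'] ln_shrink_nonpos[OF assms(2) \<pi>'] sbar_pos
    by (simp add: ln_div)
qed

lemma bellman_lipschitz_on:
  assumes "continuous_on weights v"
  shows "(cbar / ((1 - cbar) * sbar) * real CARD('n))-lipschitz_on weights (bellman_op v)"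
proof (rule lipschitz_onI)
  have L: "0 \<le> cbar / ((1 - cbar) * sbar)"
    using cbar_nonneg cbar_less_one sbar_pos by simp
  then show "0 \<le> cbar / ((1 - cbar) * sbar) * real CARD('n)" by (rule mult_nonneg_nonneg) simp
  fix \<pi>\<^sub>1 \<pi>\<^sub>2 :: "real ^ 'n" assume w: "\<pi>\<^sub>1 \<in> weights" "\<pi>\<^sub>2 \<in> weights"
  have "l1_norm (\<pi>\<^sub>1 - \<pi>\<^sub>2) \<le> (\<Sum>i\<in>(UNIV :: 'n set). norm (\<pi>\<^sub>1 - \<pi>\<^sub>2))"
    unfolding l1_norm_def by (intro sum_mono component_le_norm_cart)
  then have "cbar / ((1 - cbar) * sbar) * l1_norm (\<pi>\<^sub>1 - \<pi>\<^sub>2)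
      \<le> cbar / ((1 - cbar) * sbar) * (real CARD('n) * norm (\<pi>\<^sub>1 - \<pi>\<^sub>2))"
    using L by (intro mult_left_mono) auto
  then show "dist (bellman_op v \<pi>\<^sub>1) (bellman_op v \<pi>\<^sub>2)
      \<le> cbar / ((1 - cbar) * sbar) * real CARD('n) * dist \<pi>\<^sub>1 \<pi>\<^sub>2"
    using bellman_lipschitz[OF assms w] unfolding dist_norm real_norm_def mult.assoc by linarith
qed

lemma bellman_continuous: "continuous_on weights v \<Longrightarrow> continuous_on weights (bellman_op v)"
  using bellman_lipschitz_on lipschitz_on_continuous_on by blast

text \<open>
  The product of the shrinkage factor \<open>s\<close> and the certainty equivalent of the continuation is the
  certainty equivalent of the post-trade holdings \<open>s *\<^sub>R \<pi>'\<close>.  It is concave and positively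
  homogeneous in these holdings, and the pairs of an initial portfolio and affordable holdings
  form a convex set.  So the maximal value is concave in the initial portfolio.
\<close>

lemma bellman_concave:
  assumes cont: "continuous_on weights v" and conc: "concave_on weights (\<lambda>\<pi>. exp (v \<pi>))"
  shows "concave_on weights (\<lambda>\<pi>. exp (bellman_op v \<pi>))"
  unfolding concave_on_iff
proof (intro conjI ballI allI impI convex_weights)
  fix \<pi>\<^sub>1 \<pi>\<^sub>2 :: "real ^ 'n" and t u :: real
  assume w: "\<pi>\<^sub>1 \<in> weights" "\<pi>\<^sub>2 \<in> weights" and t: "0 \<le> t" "0 \<le> u" "t + u = 1"
  define \<pi> where "\<pi> = t *\<^sub>R \<pi>\<^sub>1 + u *\<^sub>R \<pi>\<^sub>2"
  have \<pi>: "\<pi> \<in> weights" using w t unfolding \<pi>_def by (intro convexD[OF convex_weights]) auto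
  have pair: "t * exp (ln (shrink c h \<pi>\<^sub>1 \<rho>\<^sub>1) + utility v \<rho>\<^sub>1)
      + u * exp (ln (shrink c h \<pi>\<^sub>2 \<rho>\<^sub>2) + utility v \<rho>\<^sub>2) \<le> exp (bellman_op v \<pi>)"
    if r: "\<rho>\<^sub>1 \<in> weights" "\<rho>\<^sub>2 \<in> weights" for \<rho>\<^sub>1 \<rho>\<^sub>2
  proof -
    define a b where "a = t * shrink c h \<pi>\<^sub>1 \<rho>\<^sub>1" and "b = u * shrink c h \<pi>\<^sub>2 \<rho>\<^sub>2"
    \<comment> \<open>\<open>\<rho>\<close> are the weights of the mixed post-trade holdings, whose total value is \<open>a + b\<close>.\<close>
    define p q where "p = a / (a + b)" and "q = b / (a + b)"
    define \<rho> where "\<rho> = p *\<^sub>R \<rho>\<^sub>1 + q *\<^sub>R \<rho>\<^sub>2"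
    note mix = shrink_convex_combination[OF w r t, folded a_def b_def]
    have s_ge: "a + b \<le> shrink c h \<pi> \<rho>"
      using mix(1) by (simp add: \<pi>_def \<rho>_def p_def q_def)
    have pq: "0 \<le> p" "0 \<le> q" "p + q = 1"
      using mix(2-4) by (auto simp: p_def q_def simp flip: add_divide_distrib)
    have \<rho>: "\<rho> \<in> weights" using pq r unfolding \<rho>_def by (intro convexD[OF convex_weights]) auto
    have "t * exp (ln (shrink c h \<pi>\<^sub>1 \<rho>\<^sub>1) + utility v \<rho>\<^sub>1)
        + u * exp (ln (shrink c h \<pi>\<^sub>2 \<rho>\<^sub>2) + utility v \<rho>\<^sub>2)
        = a * exp (utility v \<rho>\<^sub>1) + b * exp (utility v \<rho>\<^sub>2)"
      using shrink_pos w r by (simp add: exp_add a_def b_def)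
    also have "\<dots> = (a + b) * (p * exp (utility v \<rho>\<^sub>1) + q * exp (utility v \<rho>\<^sub>2))"
      using mix(4) by (simp add: p_def q_def distrib_left)
    also have "\<dots> \<le> (a + b) * exp (utility v \<rho>)"
      using utility_concave[OF cont conc] pq r mix(4) unfolding \<rho>_def concave_on_iff
      by (intro mult_left_mono) auto
    also have "\<dots> \<le> shrink c h \<pi> \<rho> * exp (utility v \<rho>)"
      using s_ge by (intro mult_right_mono) auto
    also have "\<dots> = exp (ln (shrink c h \<pi> \<rho>) + utility v \<rho>)"
      using shrink_pos[OF \<pi> \<rho>] by (simp add: exp_add)
    also have "\<dots> \<le> exp (bellman_op v \<pi>)"
      using bellman_ge[OF cont \<pi> \<rho>] by simp
    finally show ?thesis .
  qed
  have "t * exp (bellman_op v \<pi>\<^sub>1) + u * exp (ln (shrink c h \<pi>\<^sub>2 \<rho>\<^sub>2) + utility v \<rho>\<^sub>2)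
      \<le> exp (bellman_op v \<pi>)" if "\<rho>\<^sub>2 \<in> weights" for \<rho>\<^sub>2
    unfolding bellman_op_def[of v \<pi>\<^sub>1]
    by (intro scaled_exp_SUP_le weights_nonempty t pair that)
  then have "u * exp (bellman_op v \<pi>\<^sub>2) + t * exp (bellman_op v \<pi>\<^sub>1) \<le> exp (bellman_op v \<pi>)"
    unfolding bellman_op_def[of v \<pi>\<^sub>2]
    by (intro scaled_exp_SUP_le weights_nonempty t) (simp add: add.commute)
  then show "t * exp (bellman_op v \<pi>\<^sub>1) + u * exp (bellman_op v \<pi>\<^sub>2)
      \<le> exp (bellman_op v (t *\<^sub>R \<pi>\<^sub>1 + u *\<^sub>R \<pi>\<^sub>2))"
    by (simp add: \<pi>_def add.commute)
qed

end


section \<open>Solution of the Bellman equation by vanishing discount\<close>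

lemma concave_on_pointwise_limit:
  fixes g :: "nat \<Rightarrow> 'a::real_vector \<Rightarrow> real"
  assumes conc: "\<And>n. concave_on A (g n)" and lim: "\<And>x. x \<in> A \<Longrightarrow> (\<lambda>n. g n x) \<longlonglongrightarrow> f x"
  shows "concave_on A f"
  unfolding concave_on_iff
proof (intro conjI ballI allI impI)
  show cv: "convex A" using conc[of 0] by (simp add: concave_on_iff)
  fix x y and t u :: real
  assume a: "x \<in> A" "y \<in> A" "0 \<le> t" "0 \<le> u" "t + u = 1"
  show "t * f x + u * f y \<le> f (t *\<^sub>R x + u *\<^sub>R y)"
  proof (rule LIMSEQ_le)
    show "(\<lambda>n. t * g n x + u * g n y) \<longlonglongrightarrow> t * f x + u * f y"
      using a by (intro tendsto_intros lim)
    show "(\<lambda>n. g n (t *\<^sub>R x + u *\<^sub>R y)) \<longlonglongrightarrow> f (t *\<^sub>R x + u *\<^sub>R y)"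
      using a by (intro lim convexD[OF cv])
    show "\<exists>N. \<forall>n\<ge>N. t * g n x + u * g n y \<le> g n (t *\<^sub>R x + u *\<^sub>R y)"
      using conc a by (auto simp: concave_on_iff)
  qed
qed

lemma concave_on_cong:
  assumes "concave_on A f" "\<And>x. x \<in> A \<Longrightarrow> f x = g x"
  shows "concave_on A g"
  using assms unfolding concave_on_iff convex_def by metis

text \<open>
  A power \<open>f\<^sup>\<beta>\<close> with exponent \<open>\<beta> \<le> 1\<close> of a positive concave function is concave.  The bound
  \<open>x\<^sup>\<beta> \<le> \<beta> x + (1 - \<beta>)\<close>, applied to the values of \<open>f\<close> divided by their mean, is again convexity of
  the exponential.
\<close>

lemma concave_on_exp_scale:
  fixes v :: "'a::real_vector \<Rightarrow> real"
  assumes conc: "concave_on A (\<lambda>x. exp (v x))" and "0 \<le> \<beta>" "\<beta> \<le> 1"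
  shows "concave_on A (\<lambda>x. exp (\<beta> * v x))"
  unfolding concave_on_iff
proof (intro conjI ballI allI impI)
  show "convex A" using conc by (simp add: concave_on_iff)
  fix x y and t u :: real
  assume a: "x \<in> A" "y \<in> A" "0 \<le> t" "0 \<le> u" "t + u = 1"
  define C where "C = t * exp (v x) + u * exp (v y)"
  have C: "0 < C"
  proof (cases "t = 0")
    case False
    then show ?thesis unfolding C_def using a by (intro add_pos_nonneg) auto
  qed (use a in \<open>simp add: C_def\<close>)
  have young: "exp (\<beta> * s) \<le> \<beta> * exp s + (1 - \<beta>)" for s :: real
    using exp_convex assms(2,3) convex_onD[OF exp_convex, of \<beta> 0 s] by simp
  have pw: "exp (\<beta> * v z) \<le> exp (\<beta> * ln C) * (\<beta> * (exp (v z) / C) + (1 - \<beta>))" for z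
  proof -
    have "exp (\<beta> * v z) = exp (\<beta> * ln C) * exp (\<beta> * (v z - ln C))"
      by (simp add: algebra_simps flip: exp_add)
    also have "\<dots> \<le> exp (\<beta> * ln C) * (\<beta> * exp (v z - ln C) + (1 - \<beta>))"
      by (intro mult_left_mono young) simp
    finally show ?thesis using C by (simp add: exp_diff)
  qed
  have "t * exp (\<beta> * v x) + u * exp (\<beta> * v y)
      \<le> t * (exp (\<beta> * ln C) * (\<beta> * (exp (v x) / C) + (1 - \<beta>)))
        + u * (exp (\<beta> * ln C) * (\<beta> * (exp (v y) / C) + (1 - \<beta>)))"
    using a by (intro add_mono mult_left_mono pw)
  also have "\<dots> = exp (\<beta> * ln C) * (\<beta> * ((t * exp (v x) + u * exp (v y)) / C) + (t + u) * (1 - \<beta>))"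
    by (simp add: algebra_simps add_divide_distrib)
  also have "\<dots> = exp (\<beta> * ln C)"
    using C a by (simp flip: C_def)
  also have "\<dots> \<le> exp (\<beta> * v (t *\<^sub>R x + u *\<^sub>R y))"
  proof -
    have "exp (ln C) \<le> exp (v (t *\<^sub>R x + u *\<^sub>R y))"
      using conc a C by (simp add: C_def concave_on_iff)
    then have "ln C \<le> v (t *\<^sub>R x + u *\<^sub>R y)" by (simp only: exp_le_cancel_iff)
    then show ?thesis using assms(2) by (simp add: mult_left_mono)
  qed
  finally show "t * exp (\<beta> * v x) + u * exp (\<beta> * v y) \<le> exp (\<beta> * v (t *\<^sub>R x + u *\<^sub>R y))" .
qed

context bellman
begin

text \<open>
  Discounting turns the nonexpansive operator into a contraction.  It acts on the closed, hence
  complete, set of bounded continuous functions \<open>f\<close> with \<open>exp \<circ> f\<close> concave on the simplex;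
  composing with the metric projection extends functions from the simplex to the whole space.
\<close>

lemma discounted_fixed_point:
  assumes "0 \<le> \<beta>" "\<beta> < 1"
  obtains v where "continuous_on weights v" "concave_on weights (\<lambda>\<pi>. exp (v \<pi>))"
    "\<And>\<pi>. \<pi> \<in> weights \<Longrightarrow> v \<pi> = bellman_op (\<lambda>x. \<beta> * v x) \<pi>"
proof -
  define S where "S = {f :: (real ^ 'n) \<Rightarrow>\<^sub>C real. concave_on weights (\<lambda>\<pi>. exp (apply_bcontfun f \<pi>))}"
  define F :: "((real ^ 'n) \<Rightarrow>\<^sub>C real) \<Rightarrow> (real ^ 'n) \<Rightarrow>\<^sub>C real"
    where "F f = Bcontfun (\<lambda>x. bellman_op (\<lambda>\<pi>. \<beta> * f \<pi>) (closest_point weights x))" for f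
  have closed: "closed (weights :: (real ^ 'n) set)" by (simp add: compact_imp_closed compact_weights)
  have cp: "closest_point weights x \<in> weights" for x :: "real ^ 'n"
    by (rule closest_point_in_set[OF closed weights_nonempty])
  have cont: "continuous_on weights (\<lambda>\<pi>. \<beta> * apply_bcontfun f \<pi>)" for f :: "(real ^ 'n) \<Rightarrow>\<^sub>C real"
    by (intro continuous_intros) auto
  have F_apply: "apply_bcontfun (F f) x = bellman_op (\<lambda>\<pi>. \<beta> * f \<pi>) (closest_point weights x)" for f x
  proof -
    define g where "g = bellman_op (\<lambda>\<pi>. \<beta> * f \<pi>)"
    have g: "continuous_on weights g" unfolding g_def by (rule bellman_continuous[OF cont])
    obtain K where "\<And>\<pi>. \<pi> \<in> weights \<Longrightarrow> \<bar>g \<pi>\<bar> \<le> K"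
      using continuous_on_weights_bounded[OF g] by metis
    moreover have "continuous_on UNIV (g \<circ> closest_point weights)"
      using cp by (intro continuous_on_compose continuous_on_closest_point convex_weights closed
          weights_nonempty continuous_on_subset[OF g]) auto
    ultimately have "g \<circ> closest_point weights \<in> bcontfun"
      using cp by (intro bcontfun_normI[where b = K]) auto
    then show ?thesis
      unfolding F_def g_def by (simp add: Bcontfun_inverse comp_def)
  qed
  have "\<exists>!f\<in>S. F f = f"
  proof (rule Banach_fix[where c = \<beta>])
    have "closed S"
      unfolding closed_sequential_limits
    proof (intro allI impI, elim conjE)
      fix f :: "nat \<Rightarrow> (real ^ 'n) \<Rightarrow>\<^sub>C real" and l
      assume f: "\<forall>n. f n \<in> S" "f \<longlonglongrightarrow> l"
      have "(\<lambda>n. f n x) \<longlonglongrightarrow> l x" for x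
        using tendsto_uniform_limitI[OF tendsto_bcontfun_uniform_limit[OF f(2)]] by simp
      then have lim: "(\<lambda>n. exp (f n x)) \<longlonglongrightarrow> exp (l x)" for x
        by (intro tendsto_exp)
      have "concave_on weights (\<lambda>\<pi>. exp (l \<pi>))"
        by (rule concave_on_pointwise_limit[OF _ lim]) (use f(1) in \<open>auto simp: S_def\<close>)
      then show "l \<in> S" by (simp add: S_def)
    qed
    then show "Topological_Spaces.complete S" by (simp add: complete_eq_closed)
    have "0 \<in> S" by (simp add: S_def concave_on_iff convex_weights)
    then show "S \<noteq> {}" by auto
    show "0 \<le> \<beta>" "\<beta> < 1" by fact+
    show "F ` S \<subseteq> S"
    proof (rule image_subsetI)
      fix f assume "f \<in> S"
      then have "concave_on weights (\<lambda>\<pi>. exp (bellman_op (\<lambda>\<pi>. \<beta> * f \<pi>) \<pi>))"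
        using assms by (intro bellman_concave cont concave_on_exp_scale) (auto simp: S_def)
      then show "F f \<in> S"
        unfolding S_def mem_Collect_eq
        by (rule concave_on_cong) (simp add: F_apply closest_point_self)
    qed
    fix f g assume "f \<in> S" "g \<in> S"
    show "dist (F f) (F g) \<le> \<beta> * dist f g"
    proof (rule dist_bound)
      fix x
      have "\<bar>\<beta> * f \<pi> - \<beta> * g \<pi>\<bar> \<le> \<beta> * dist f g" for \<pi>
        using dist_bounded[of f \<pi> g] assms(1)
        by (simp add: dist_real_def abs_mult mult_left_mono flip: right_diff_distrib)
      then show "dist (F f x) (F g x) \<le> \<beta> * dist f g"
        unfolding F_apply dist_real_def by (intro bellman_nonexpansive cont cp)
    qed
  qed
  then obtain f where f: "f \<in> S" "F f = f" by blast
  show ?thesis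
  proof (rule that)
    show "continuous_on weights (apply_bcontfun f)" by auto
    show "concave_on weights (\<lambda>\<pi>. exp (f \<pi>))" using f(1) by (simp add: S_def)
    fix \<pi> :: "real ^ 'n" assume "\<pi> \<in> weights"
    then show "f \<pi> = bellman_op (\<lambda>x. \<beta> * f x) \<pi>"
      using F_apply[of f \<pi>] f(2) by (simp add: closest_point_self)
  qed
qed

text \<open>
  Subtracting the value at \<open>\<pi>\<^sub>0\<close> removes the part of the discounted value function that may
  diverge as \<open>\<beta> \<rightarrow> 1\<close>; the constant moves through the operator.
\<close>

lemma normalised_discounted_solution:
  assumes "0 \<le> \<beta>" "\<beta> < 1" "\<pi>\<^sub>0 \<in> weights"
  obtains w where "continuous_on weights w" "concave_on weights (\<lambda>\<pi>. exp (w \<pi>))"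
    "\<And>\<pi>. \<pi> \<in> weights \<Longrightarrow>
      w \<pi> = bellman_op (\<lambda>x. \<beta> * w x) \<pi> - bellman_op (\<lambda>x. \<beta> * w x) \<pi>\<^sub>0"
proof -
  obtain v where v: "continuous_on weights v" "concave_on weights (\<lambda>\<pi>. exp (v \<pi>))"
    and fp: "\<And>\<pi>. \<pi> \<in> weights \<Longrightarrow> v \<pi> = bellman_op (\<lambda>x. \<beta> * v x) \<pi>"
    using discounted_fixed_point[OF assms(1,2)] by metis
  define w where "w \<pi> = v \<pi> - v \<pi>\<^sub>0" for \<pi>
  have w: "continuous_on weights w" unfolding w_def by (intro continuous_intros v)
  have "concave_on weights (\<lambda>\<pi>. exp (- v \<pi>\<^sub>0) * exp (v \<pi>))"
    using v(2) by (rule concave_on_cmul[rotated]) simp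
  then have conc: "concave_on weights (\<lambda>\<pi>. exp (w \<pi>))"
    by (simp add: w_def flip: exp_add)
  have shift: "bellman_op (\<lambda>x. \<beta> * v x) \<pi> = bellman_op (\<lambda>x. \<beta> * w x) \<pi> + \<beta> * v \<pi>\<^sub>0"
    if "\<pi> \<in> weights" for \<pi>
  proof -
    have "(\<lambda>x. \<beta> * v x) = (\<lambda>x. \<beta> * w x + \<beta> * v \<pi>\<^sub>0)"
      by (simp add: w_def algebra_simps)
    then show ?thesis
      using bellman_add[of "\<lambda>x. \<beta> * w x" \<pi>] that w by (simp add: continuous_on_mult_left)
  qed
  have "w \<pi> = bellman_op (\<lambda>x. \<beta> * w x) \<pi> - bellman_op (\<lambda>x. \<beta> * w x) \<pi>\<^sub>0"
    if "\<pi> \<in> weights" for \<pi>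
  proof -
    have "w \<pi> = v \<pi> - v \<pi>\<^sub>0" by (simp add: w_def)
    then show ?thesis
      using fp[OF that] fp[OF assms(3)] shift[OF that] shift[OF assms(3)] by linarith
  qed
  with w conc show ?thesis by (rule that)
qed

lemma bellman_op_diff:
  assumes "continuous_on weights v" "\<pi> \<in> weights"
  shows "(SUP \<pi>'\<in>weights. ln (shrink c h \<pi> \<pi>') - k + utility v \<pi>') = bellman_op v \<pi> - k"
proof (rule antisym)
  have bdd: "bdd_above ((\<lambda>\<pi>'. ln (shrink c h \<pi> \<pi>') - k + utility v \<pi>') ` weights)"
    using bellman_ge[OF assms] by (intro bdd_aboveI2[where M = "bellman_op v \<pi> - k"]) (smt (verit))
  show "(SUP \<pi>'\<in>weights. ln (shrink c h \<pi> \<pi>') - k + utility v \<pi>') \<le> bellman_op v \<pi> - k"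
    using bellman_ge[OF assms] by (intro cSUP_least weights_nonempty) (smt (verit))
  have "bellman_op v \<pi> \<le> (SUP \<pi>'\<in>weights. ln (shrink c h \<pi> \<pi>') - k + utility v \<pi>') + k"
    using cSUP_upper[OF _ bdd] by (intro bellman_le) (smt (verit))
  then show "bellman_op v \<pi> - k \<le> (SUP \<pi>'\<in>weights. ln (shrink c h \<pi> \<pi>') - k + utility v \<pi>')"
    by linarith
qed

lemma bellman_tendsto:
  assumes "\<And>n. continuous_on weights (f n)" "continuous_on weights g"
    and lim: "uniform_limit weights f g sequentially" and "\<pi> \<in> weights"
  shows "(\<lambda>n. bellman_op (f n) \<pi>) \<longlonglongrightarrow> bellman_op g \<pi>"
proof (rule tendstoI)
  fix e :: real assume "0 < e"
  then have "\<forall>\<^sub>F n in sequentially. \<forall>\<pi>\<in>weights. dist (f n \<pi>) (g \<pi>) < e / 2"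
    using lim by (intro uniform_limitD) auto
  then show "\<forall>\<^sub>F n in sequentially. dist (bellman_op (f n) \<pi>) (bellman_op g \<pi>) < e"
  proof eventually_elim
    case (elim n)
    then have "\<bar>bellman_op (f n) \<pi> - bellman_op g \<pi>\<bar> \<le> e / 2"
      by (intro bellman_nonexpansive assms) (auto simp: dist_real_def less_imp_le)
    then show ?case using \<open>0 < e\<close> by (simp add: dist_real_def)
  qed
qed

text \<open>
  The normalised discounted solutions are bounded and equicontinuous uniformly in the discount
  factor, because they lie in the range of the operator up to constants.  A limit along
  discount factors tending to one solves the undiscounted equation.
\<close>

theorem ergodic_solution:
  assumes \<pi>\<^sub>0: "\<pi>\<^sub>0 \<in> weights"
  obtains g where "continuous_on weights g" "concave_on weights (\<lambda>\<pi>. exp (g \<pi>))"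
    "\<And>\<pi>. \<pi> \<in> weights \<Longrightarrow> g \<pi> = bellman_op g \<pi> - bellman_op g \<pi>\<^sub>0"
proof -
  \<comment> \<open>Any sequence in \<open>[0, 1)\<close> that tends to one would do.\<close>
  define \<beta> :: "nat \<Rightarrow> real" where "\<beta> n = real n / real (Suc n)" for n
  have \<beta>: "0 \<le> \<beta> n" "\<beta> n < 1" for n by (auto simp: \<beta>_def)
  have "\<exists>w. continuous_on weights w \<and> concave_on weights (\<lambda>\<pi>. exp (w \<pi>)) \<and>
      (\<forall>\<pi>\<in>weights. w \<pi> = bellman_op (\<lambda>x. \<beta> n * w x) \<pi> - bellman_op (\<lambda>x. \<beta> n * w x) \<pi>\<^sub>0)" for n
    using normalised_discounted_solution[OF \<beta> \<pi>\<^sub>0, of n] by metis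
  then obtain w where cont: "\<And>n. continuous_on weights (w n)"
    and conc: "\<And>n. concave_on weights (\<lambda>\<pi>. exp (w n \<pi>))"
    and eq: "\<And>n \<pi>. \<pi> \<in> weights \<Longrightarrow>
      w n \<pi> = bellman_op (\<lambda>x. \<beta> n * w n x) \<pi> - bellman_op (\<lambda>x. \<beta> n * w n x) \<pi>\<^sub>0"
    by metis
  have \<beta>w: "continuous_on weights (\<lambda>x. \<beta> n * w n x)" for n
    by (intro continuous_intros cont)
  define L where "L = cbar / ((1 - cbar) * sbar) * real CARD('n)"
  have lip: "L-lipschitz_on weights (bellman_op (\<lambda>x. \<beta> n * w n x))" for n
    unfolding L_def by (rule bellman_lipschitz_on[OF \<beta>w])
  have L: "0 \<le> L" using lip by (rule lipschitz_on_nonneg)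
  obtain g k where g: "continuous_on weights g" and k: "strict_mono (k :: nat \<Rightarrow> nat)"
    and conv: "\<And>e. 0 < e \<Longrightarrow> \<exists>N. \<forall>n x. n \<ge> N \<and> x \<in> weights \<longrightarrow> norm (w (k n) x - g x) < e"
  proof (rule Arzela_Ascoli[OF compact_weights, of w "ln (1 / sbar)"])
    fix n and x :: "real ^ 'n" assume "x \<in> weights"
    then show "norm (w n x) \<le> ln (1 / sbar)"
      using bellman_oscillation[OF \<beta>w _ \<pi>\<^sub>0, of x n] bellman_oscillation[OF \<beta>w \<pi>\<^sub>0, of x n]
        eq[of x n] unfolding real_norm_def abs_le_iff by linarith
  next
    fix x :: "real ^ 'n" and e :: real assume x: "x \<in> weights" and e: "0 < e"
    have "norm (w n x - w n y) < e" if y: "y \<in> weights" and d: "norm (x - y) < e / (L + 1)" for n y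
    proof -
      have "norm (w n x - w n y) \<le> L * norm (x - y)"
        using lipschitz_onD[OF lip x y, of n] eq[OF x, of n] eq[OF y, of n]
        unfolding dist_norm real_norm_def by linarith
      also have "\<dots> \<le> (L + 1) * norm (x - y)" by (simp add: mult_right_mono)
      also have "\<dots> < e" using d L by (simp add: field_simps)
      finally show ?thesis .
    qed
    then show "\<exists>d. 0 < d \<and> (\<forall>n y. y \<in> weights \<and> norm (x - y) < d \<longrightarrow> norm (w n x - w n y) < e)"
      using e L by (intro exI[of _ "e / (L + 1)"]) auto
  qed auto
  have ulim: "uniform_limit weights (\<lambda>n. w (k n)) g sequentially"
    using conv unfolding uniform_limit_sequentially_iff dist_norm by blast
  have "\<beta> \<longlonglongrightarrow> 1" unfolding \<beta>_def by (rule LIMSEQ_n_over_Suc_n)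
  then have "(\<beta> \<circ> k) \<longlonglongrightarrow> 1" using k by (rule LIMSEQ_subseq_LIMSEQ)
  then have ulim_\<beta>: "uniform_limit weights (\<lambda>n x. \<beta> (k n)) (\<lambda>x. 1) sequentially"
    by (auto simp: uniform_limit_iff tendsto_iff)
  have "bounded (g ` weights)"
    by (rule compact_imp_bounded[OF compact_continuous_image[OF g compact_weights]])
  then have ulim': "uniform_limit weights (\<lambda>n x. \<beta> (k n) * w (k n) x) g sequentially"
    using uniform_lim_mult[OF ulim_\<beta> ulim] by (simp add: image_constant_conv)
  have pointwise: "(\<lambda>n. w (k n) \<pi>) \<longlonglongrightarrow> g \<pi>" if "\<pi> \<in> weights" for \<pi>
    by (rule tendsto_uniform_limitI[OF ulim that])
  show ?thesis
  proof (rule that)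
    show "concave_on weights (\<lambda>\<pi>. exp (g \<pi>))"
      by (rule concave_on_pointwise_limit[where g = "\<lambda>n \<pi>. exp (w (k n) \<pi>)"])
        (intro conc tendsto_exp pointwise)+
    fix \<pi> :: "real ^ 'n" assume \<pi>: "\<pi> \<in> weights"
    have "(\<lambda>n. bellman_op (\<lambda>x. \<beta> (k n) * w (k n) x) \<pi> - bellman_op (\<lambda>x. \<beta> (k n) * w (k n) x) \<pi>\<^sub>0)
        \<longlonglongrightarrow> bellman_op g \<pi> - bellman_op g \<pi>\<^sub>0"
      by (intro tendsto_diff bellman_tendsto \<beta>w g ulim' \<pi> \<pi>\<^sub>0)
    then have "(\<lambda>n. w (k n) \<pi>) \<longlonglongrightarrow> bellman_op g \<pi> - bellman_op g \<pi>\<^sub>0"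
      unfolding eq[OF \<pi>, symmetric] .
    with pointwise[OF \<pi>] show "g \<pi> = bellman_op g \<pi> - bellman_op g \<pi>\<^sub>0"
      by (rule LIMSEQ_unique)
  qed (rule g)
qed

end


section \<open>Concavity of the lift\<close>

lemma orthant_inner_one_pos:
  assumes "x \<in> orthant" "x \<noteq> 0"
  shows "0 < x \<bullet> (1 :: real ^ 'n)"
proof -
  obtain i where "x $ i \<noteq> 0" using assms(2) by (auto simp: vec_eq_iff)
  then have "0 < x $ i" using assms(1) by (simp add: orthant_def less_le)
  then show ?thesis
    unfolding inner_one_eq_sum using assms(1) by (intro sum_pos2[of _ i]) (auto simp: orthant_def)
qed

lemma orthant_normalised_mem:
  assumes "x \<in> orthant" "x \<noteq> 0"
  shows "(1 / (x \<bullet> 1)) *\<^sub>R x \<in> weights"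
  using orthant_inner_one_pos[OF assms] assms(1)
  by (auto simp: weights_def orthant_def)

lemma wealth_lift_positively_homogeneous:
  "positively_homogeneous_on orthant (wealth_lift (v :: real ^ 'n \<Rightarrow> real))"
  unfolding positively_homogeneous_on_def
proof (intro ballI allI impI)
  fix x :: "real ^ 'n" and a :: real assume "x \<in> orthant" "0 \<le> a"
  then show "wealth_lift v (a *\<^sub>R x) = a * wealth_lift v x"
    using orthant_inner_one_pos[of x] by (cases "x = 0 \<or> a = 0") (auto simp: wealth_lift_def)
qed

text \<open>
  The lift is the perspective of \<open>exp \<circ> v\<close>: a sum of two portfolios has weights that average
  those of the summands in proportion to their wealth, so concavity on the simplex gives
  superadditivity.
\<close>

lemma wealth_lift_superadditive:
  fixes v :: "real ^ 'n \<Rightarrow> real"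
  assumes conc: "concave_on weights (\<lambda>\<pi>. exp (v \<pi>))" and "x \<in> orthant" "y \<in> orthant"
  shows "wealth_lift v x + wealth_lift v y \<le> wealth_lift v (x + y)"
proof (cases "x = 0 \<or> y = 0")
  case True
  then show ?thesis by (auto simp: wealth_lift_def)
next
  case False
  define X Y where "X = x \<bullet> (1 :: real ^ 'n)" and "Y = y \<bullet> (1 :: real ^ 'n)"
  \<comment> \<open>The weights of the summands; those of \<open>x + y\<close> are their average with masses \<open>X\<close> and \<open>Y\<close>.\<close>
  define x' y' where "x' = (1 / X) *\<^sub>R x" and "y' = (1 / Y) *\<^sub>R y"
  have pos: "0 < X" "0 < Y"
    using False assms(2,3) orthant_inner_one_pos by (auto simp: X_def Y_def)
  have mem: "x' \<in> weights" "y' \<in> weights"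
    using False assms(2,3) orthant_normalised_mem by (auto simp: x'_def y'_def X_def Y_def)
  have sum: "(x + y) \<bullet> 1 = X + Y" by (simp add: X_def Y_def inner_add_left)
  then have nz: "x + y \<noteq> 0" using pos by auto
  have split: "(1 / (X + Y)) *\<^sub>R (x + y) = (X / (X + Y)) *\<^sub>R x' + (Y / (X + Y)) *\<^sub>R y'"
    using pos by (simp add: x'_def y'_def scaleR_add_right)
  have "X / (X + Y) + Y / (X + Y) = 1"
    using pos by (simp flip: add_divide_distrib)
  then have "X / (X + Y) * exp (v x') + Y / (X + Y) * exp (v y')
      \<le> exp (v ((1 / (X + Y)) *\<^sub>R (x + y)))"
    unfolding split
    using conc[unfolded concave_on_iff, THEN conjunct2, rule_format, OF mem] pos by (metis less_imp_le add_pos_pos divide_pos_pos)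
  then have "(X + Y) * (X / (X + Y) * exp (v x') + Y / (X + Y) * exp (v y'))
      \<le> (X + Y) * exp (v ((1 / (X + Y)) *\<^sub>R (x + y)))"
    using pos by (intro mult_left_mono) auto
  moreover have "(X + Y) * (X / (X + Y) * exp (v x') + Y / (X + Y) * exp (v y'))
      = X * exp (v x') + Y * exp (v y')"
    using pos by (simp add: distrib_left)
  ultimately show ?thesis
    using False nz by (simp add: wealth_lift_def sum x'_def y'_def flip: X_def Y_def)
qed

lemma wealth_lift_concave:
  fixes v :: "real ^ 'n \<Rightarrow> real"
  assumes "concave_on weights (\<lambda>\<pi>. exp (v \<pi>))"
  shows "concave_on orthant (wealth_lift v)"
  unfolding concave_on_iff
proof (intro conjI ballI allI impI)
  show "convex (orthant :: (real ^ 'n) set)" by (auto simp: convex_def orthant_def)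
  fix x y :: "real ^ 'n" and t u :: real
  assume a: "x \<in> orthant" "y \<in> orthant" "0 \<le> t" "0 \<le> u" "t + u = 1"
  have "t *\<^sub>R x \<in> orthant" "u *\<^sub>R y \<in> orthant" using a by (auto simp: orthant_def)
  from wealth_lift_superadditive[OF assms this]
  show "t * wealth_lift v x + u * wealth_lift v y \<le> wealth_lift v (t *\<^sub>R x + u *\<^sub>R y)"
    using wealth_lift_positively_homogeneous[of v] a by (simp add: positively_homogeneous_on_def)
qed


section \<open>Prices at a random time\<close>

lemma borel_measurable_vecI:
  fixes f :: "'w \<Rightarrow> real ^ 'n"
  assumes "\<And>i. (\<lambda>\<omega>. f \<omega> $ i) \<in> borel_measurable M"
  shows "f \<in> borel_measurable M"
  by (subst borel_measurable_euclidean_space) (auto simp: Basis_vec_def inner_axis assms)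

text \<open>
  A right-continuous process is observed at a random time as a limit of observations at times
  on finer and finer grids, rounded strictly upwards.
\<close>

lemma right_continuous_random_time_measurable:
  fixes X :: "real \<Rightarrow> 'w \<Rightarrow> 'b :: metric_space"
  assumes X: "\<And>t. 0 \<le> t \<Longrightarrow> X t \<in> borel_measurable M"
    and right: "\<And>\<omega> t. \<omega> \<in> space M \<Longrightarrow> 0 \<le> t \<Longrightarrow> continuous (at_right t) (\<lambda>u. X u \<omega>)"
    and T: "T \<in> borel_measurable M" "\<And>\<omega>. \<omega> \<in> space M \<Longrightarrow> 0 \<le> T \<omega>"
  shows "(\<lambda>\<omega>. X (T \<omega>) \<omega>) \<in> borel_measurable M"
proof -
  define K where "K n \<omega> = nat \<lfloor>real (Suc n) * T \<omega>\<rfloor>" for n \<omega>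
  define t where "t n \<omega> = (real (K n \<omega>) + 1) / real (Suc n)" for n \<omega>
  have t: "T \<omega> < t n \<omega>" "t n \<omega> \<le> T \<omega> + 1 / real (Suc n)" if "\<omega> \<in> space M" for n \<omega>
  proof -
    have "0 \<le> real (Suc n) * T \<omega>" using T(2)[OF that] by simp
    then have "real (K n \<omega>) \<le> real (Suc n) * T \<omega>" "real (Suc n) * T \<omega> < real (K n \<omega>) + 1"
      unfolding K_def by linarith+
    then have "T \<omega> < (real (K n \<omega>) + 1) / real (Suc n)" "real (K n \<omega>) / real (Suc n) \<le> T \<omega>"
      by (simp_all add: pos_less_divide_eq pos_divide_le_eq mult.commute)
    then show "T \<omega> < t n \<omega>" "t n \<omega> \<le> T \<omega> + 1 / real (Suc n)"
      by (simp_all add: t_def add_divide_distrib)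
  qed
  show ?thesis
  proof (rule borel_measurable_LIMSEQ_metric)
    fix n
    show "(\<lambda>\<omega>. X (t n \<omega>) \<omega>) \<in> borel_measurable M"
      unfolding t_def
    proof (rule measurable_compose_countable[where f = "\<lambda>k \<omega>. X ((real k + 1) / real (Suc n)) \<omega>"])
      show "X ((real k + 1) / real (Suc n)) \<in> borel_measurable M" for k
        by (rule X) simp
      have [measurable]: "T \<in> borel_measurable M" by (rule T)
      show "K n \<in> measurable M (count_space UNIV)"
        unfolding K_def by measurable
    qed
  next
    fix \<omega> assume \<omega>: "\<omega> \<in> space M"
    have "(\<lambda>n. T \<omega> + 1 / real (Suc n)) \<longlonglongrightarrow> T \<omega> + 0"
      by (rule tendsto_add[OF tendsto_const LIMSEQ_Suc[OF lim_1_over_n]])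
    then have upper: "(\<lambda>n. T \<omega> + 1 / real (Suc n)) \<longlonglongrightarrow> T \<omega>" by (simp only: add_0_right)
    have "(\<lambda>n. t n \<omega>) \<longlonglongrightarrow> T \<omega>"
      by (rule tendsto_sandwich[OF _ _ tendsto_const upper])
        (intro always_eventually allI less_imp_le t(1)[OF \<omega>] t(2)[OF \<omega>])+
    then have "filterlim (\<lambda>n. t n \<omega>) (at_right (T \<omega>)) sequentially"
      using t(1)[OF \<omega>] by (simp add: filterlim_at less_imp_neq[THEN not_sym])
    moreover have "((\<lambda>u. X u \<omega>) \<longlongrightarrow> X (T \<omega>) \<omega>) (at_right (T \<omega>))"
      using right[OF \<omega> T(2)[OF \<omega>]] by (simp add: continuous_within)
    ultimately show "(\<lambda>n. X (t n \<omega>) \<omega>) \<longlonglongrightarrow> X (T \<omega>) \<omega>"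
      by (rule filterlim_compose[rotated])
  qed
qed

lemma gross_return_measurable:
  fixes S :: "real \<Rightarrow> 'w \<Rightarrow> real ^ 'n"
  assumes S: "\<And>t. 0 \<le> t \<Longrightarrow> S t \<in> borel_measurable M"
    and pos: "\<And>t \<omega> i. 0 \<le> t \<Longrightarrow> \<omega> \<in> space M \<Longrightarrow> 0 < S t \<omega> $ i"
    and right: "right_continuous_paths M (\<lambda>t \<omega>. ln_vec (S t \<omega>))"
    and T: "T \<in> borel_measurable M" "\<And>\<omega>. \<omega> \<in> space M \<Longrightarrow> 0 \<le> T \<omega>"
  shows "gross_return S T \<in> borel_measurable M"
proof (rule borel_measurable_vecI)
  fix i
  have X: "(\<lambda>\<omega>. ln_vec (S t \<omega>)) \<in> borel_measurable M" if "0 \<le> t" for t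
  proof (rule borel_measurable_vecI)
    fix j
    have [measurable]: "(\<lambda>\<omega>. S t \<omega> $ j) \<in> borel_measurable M"
      by (rule borel_measurable_vec_component[OF S[OF that]])
    show "(\<lambda>\<omega>. ln_vec (S t \<omega>) $ j) \<in> borel_measurable M"
      unfolding ln_vec_def vec_lambda_beta by measurable
  qed
  have "(\<lambda>\<omega>. ln_vec (S (T \<omega>) \<omega>)) \<in> borel_measurable M"
  proof (rule right_continuous_random_time_measurable[where X = "\<lambda>t \<omega>. ln_vec (S t \<omega>)"])
    show "continuous (at_right t) (\<lambda>u. ln_vec (S u \<omega>))" if "\<omega> \<in> space M" "0 \<le> t" for \<omega> t
      using right that by (simp add: right_continuous_paths_def)
  qed (fact X T)+
  then have [measurable]: "(\<lambda>\<omega>. ln_vec (S (T \<omega>) \<omega>) $ i) \<in> borel_measurable M"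
    by (rule borel_measurable_vec_component)
  have [measurable]: "(\<lambda>\<omega>. S 0 \<omega> $ i) \<in> borel_measurable M"
    by (rule borel_measurable_vec_component[OF S]) simp
  have "(\<lambda>\<omega>. exp (ln_vec (S (T \<omega>) \<omega>) $ i) / S 0 \<omega> $ i) \<in> borel_measurable M"
    by measurable
  then show "(\<lambda>\<omega>. gross_return S T \<omega> $ i) \<in> borel_measurable M"
    by (rule measurable_cong[THEN iffD1, rotated])
      (simp add: gross_return_def price_ratio_def ln_vec_def pos T(2))
qed

section \<open>Existence of a solution\<close>

theorem theorem3p10:
  fixes M :: "'w measure"
    and S :: "real \<Rightarrow> 'w \<Rightarrow> real ^ 'n"
    and \<eta> :: "nat \<Rightarrow> 'w \<Rightarrow> real"
    and c h \<pi>\<^sub>0 :: "real ^ 'n"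
    and \<gamma> :: real
  assumes "\<And>i. 0 \<le> c $ i \<and> c $ i < 1"
    and "\<And>i. 0 \<le> h $ i \<and> h $ i < 1"
    and "market M S \<eta>"
    and "increments_assm M S"
    and "waiting_times_assm M \<eta>"
    and "integrability_assm M S \<eta>"
    and "\<gamma> \<le> 0"
    and "\<pi>\<^sub>0 \<in> weights"
  shows "\<exists>(v :: real ^ 'n \<Rightarrow> real) (lam :: real).
    bounded_continuous v \<and>
    (\<forall>\<pi>\<in>weights. v \<pi> =
       (SUP \<pi>'\<in>weights. ln (shrink c h \<pi> \<pi>') - lam * (LINT \<omega>|M. \<eta> 1 \<omega>)
          + continuation_utility M S \<eta> \<gamma> v \<pi>')) \<and>
    (concave_on orthant (wealth_lift v) \<and> positively_homogeneous_on orthant (wealth_lift v)) \<and>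
    (\<exists>\<pi>\<^sub>m\<in>weights. (\<forall>\<pi>\<in>weights. v \<pi> \<le> v \<pi>\<^sub>m) \<and>
       (\<forall>x\<in>orthant.
          shrink_bound c h * (x \<bullet> 1) \<le> wealth_lift (\<lambda>\<pi>. v \<pi> - v \<pi>\<^sub>m) x \<and>
          wealth_lift (\<lambda>\<pi>. v \<pi> - v \<pi>\<^sub>m) x \<le> x \<bullet> 1)) \<and>
    (\<forall>\<pi>\<in>weights. \<forall>\<pi>'\<in>weights.
       \<bar>v \<pi> - v \<pi>'\<bar>
         \<le> cost_bound c h / ((1 - cost_bound c h) * shrink_bound c h) * l1_norm (\<pi> - \<pi>')) \<and>
    (SUP \<pi>\<in>weights. v \<pi>) - (INF \<pi>\<in>weights. v \<pi>) \<le> ln (1 / shrink_bound c h) \<and>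
    lam = 1 / (LINT \<omega>|M. \<eta> 1 \<omega>) * bellman_operator M S \<eta> c h \<gamma> v \<pi>\<^sub>0"
proof -
  interpret prob_space M using assms(3) by (simp add: market_def)
  have S_meas: "S t \<in> borel_measurable M" if "0 \<le> t" for t
    using assms(3) that by (simp add: market_def)
  have S_pos: "0 < S t \<omega> $ i" if "0 \<le> t" "\<omega> \<in> space M" for t \<omega> i
    using assms(3) that by (simp add: market_def)
  have \<eta>_pos: "0 < \<eta> 1 \<omega>" if "\<omega> \<in> space M" for \<omega>
    using assms(3) that by (simp add: market_def)
  have \<eta>_int: "integrable M (\<eta> 1)"
    using assms(5) by (simp add: waiting_times_assm_def)
  define R where "R = gross_return S (\<eta> 1)"
  have R_meas: "R \<in> borel_measurable M"
    unfolding R_def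
  proof (rule gross_return_measurable)
    show "right_continuous_paths M (\<lambda>t \<omega>. ln_vec (S t \<omega>))"
      using assms(4) by (simp add: increments_assm_def Let_def)
  qed (use S_meas S_pos \<eta>_pos \<eta>_int in \<open>auto intro: less_imp_le\<close>)
  have ln_R: "log_return S (\<eta> 1) \<omega> $ i = ln (R \<omega> $ i)" for \<omega> i
    by (simp add: log_return_def ln_vec_def R_def)
  have integrability: "\<And>\<delta>. \<delta> < 0 \<Longrightarrow> integrable M (\<lambda>\<omega>. exp (\<delta> * Min (range (\<lambda>i. ln (R \<omega> $ i)))))"
    "integrable M (\<lambda>\<omega>. Max (range (\<lambda>i. ln (R \<omega> $ i))))"
    using assms(6) unfolding integrability_assm_def ln_R by blast+
  interpret bellman c h M R \<gamma>
  proof unfold_locales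
    fix \<omega> i assume \<omega>: "\<omega> \<in> space M"
    then show "0 < R \<omega> $ i"
      using S_pos \<eta>_pos[OF \<omega>] by (simp add: R_def gross_return_def price_ratio_def)
  qed (use assms(1,2,7) R_meas integrability in auto)
  have cont_util: "continuation_utility M S \<eta> \<gamma> v = utility v" for v
    unfolding continuation_utility_def utility_def growth_def[abs_def] R_def[symmetric] ..
  have op_eq: "bellman_operator M S \<eta> c h \<gamma> v \<pi> = bellman_op v \<pi>" for v \<pi>
    by (simp add: bellman_operator_def bellman_op_def cont_util)
  define E where "E = (LINT \<omega>|M. \<eta> 1 \<omega>)"
  have E: "0 < E" unfolding E_def by (rule expectation_pos[OF \<eta>_int \<eta>_pos])
  obtain v where cont: "continuous_on weights v"
    and conc: "concave_on weights (\<lambda>\<pi>. exp (v \<pi>))"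
    and eq: "\<And>\<pi>. \<pi> \<in> weights \<Longrightarrow> v \<pi> = bellman_op v \<pi> - bellman_op v \<pi>\<^sub>0"
    using ergodic_solution[OF assms(8)] by metis
  define lam where "lam = 1 / E * bellman_op v \<pi>\<^sub>0"
  have lam_E: "lam * E = bellman_op v \<pi>\<^sub>0" using E by (simp add: lam_def)
  have osc: "v \<pi> - v \<pi>' \<le> ln (1 / sbar)" if "\<pi> \<in> weights" "\<pi>' \<in> weights" for \<pi> \<pi>'
    using bellman_oscillation[OF cont that] eq[OF that(1)] eq[OF that(2)] by linarith
  obtain \<pi>\<^sub>m where \<pi>\<^sub>m: "\<pi>\<^sub>m \<in> weights" "\<And>\<pi>. \<pi> \<in> weights \<Longrightarrow> v \<pi> \<le> v \<pi>\<^sub>m"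
    using continuous_attains_sup[OF compact_weights weights_nonempty cont] by auto
  have bc: "bounded_continuous v"
    unfolding bounded_continuous_def
    using cont compact_imp_bounded[OF compact_continuous_image[OF cont compact_weights]] by simp
  have bellman_eq: "v \<pi> = (SUP \<pi>'\<in>weights. ln (shrink c h \<pi> \<pi>') - lam * E + utility v \<pi>')"
    if \<pi>: "\<pi> \<in> weights" for \<pi>
    using eq[OF \<pi>] bellman_op_diff[OF cont \<pi>, of "lam * E"] lam_E by linarith
  have lift_bounds: "shrink_bound c h * (x \<bullet> 1) \<le> wealth_lift (\<lambda>\<pi>. v \<pi> - v \<pi>\<^sub>m) x \<and>
      wealth_lift (\<lambda>\<pi>. v \<pi> - v \<pi>\<^sub>m) x \<le> x \<bullet> 1" if x: "x \<in> orthant" for x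
  proof (cases "x = 0")
    case False
    let ?d = "v ((1 / (x \<bullet> 1)) *\<^sub>R x) - v \<pi>\<^sub>m"
    note mem = orthant_normalised_mem[OF x False]
    have "ln sbar \<le> ?d"
      using osc[OF \<pi>\<^sub>m(1) mem] sbar_pos by (simp add: ln_div)
    then have "sbar \<le> exp ?d" using sbar_pos by (metis exp_le_cancel_iff exp_ln)
    moreover have "exp ?d \<le> 1" using \<pi>\<^sub>m(2)[OF mem] by simp
    ultimately show ?thesis
      using orthant_inner_one_pos[OF x False] False by (simp add: wealth_lift_def mult.commute)
  qed (simp add: wealth_lift_def)
  have lipschitz: "\<bar>v \<pi> - v \<pi>'\<bar> \<le> cbar / ((1 - cbar) * sbar) * l1_norm (\<pi> - \<pi>')"
    if "\<pi> \<in> weights" "\<pi>' \<in> weights" for \<pi> \<pi>'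
    using bellman_lipschitz[OF cont that] eq[OF that(1)] eq[OF that(2)] by linarith
  have oscillation: "(SUP \<pi>\<in>weights. v \<pi>) - (INF \<pi>\<in>weights. v \<pi>) \<le> ln (1 / sbar)"
  proof -
    have "v \<pi> \<le> ln (1 / sbar) + (INF \<pi>\<in>weights. v \<pi>)" if \<pi>: "\<pi> \<in> weights" for \<pi>
    proof -
      have "v \<pi> - ln (1 / sbar) \<le> (INF \<pi>\<in>weights. v \<pi>)"
        by (rule cINF_greatest[OF weights_nonempty]) (use osc[OF \<pi>] in \<open>simp add: algebra_simps\<close>)
      then show ?thesis by linarith
    qed
    then have "(SUP \<pi>\<in>weights. v \<pi>) \<le> ln (1 / sbar) + (INF \<pi>\<in>weights. v \<pi>)"
      by (intro cSUP_least weights_nonempty)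
    then show ?thesis by linarith
  qed
  show ?thesis
    unfolding cont_util op_eq E_def[symmetric]
    by (intro exI[of _ v] exI[of _ lam] conjI ballI bexI[of _ \<pi>\<^sub>m] bc bellman_eq
        wealth_lift_concave[OF conc] wealth_lift_positively_homogeneous \<pi>\<^sub>m
        lift_bounds[THEN conjunct1] lift_bounds[THEN conjunct2] lipschitz oscillation lam_def)
qed

end
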